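(* There are isomorphisms $\psi:B_6\to C_6$ (in type $E_6^{(1)}$) and $\psi:B_7\to C_7$ (in type $E_7^{(1)}$) of classical crystals, where $B_6$, $B_7$ are the crystal bases of the level $0$ fundamental representations $W(\varpi_1)$ (type $E_6^{(1)}$) and $W(\varpi_7)$ (type $E_7^{(1)}$), and $C_6$, $C_7$ are the classical crystals of equivalence classes of Young columns in the respective types.
   Context: **Notation.** $\hat{\mathfrak g}$ is of type $E_6^{(1)}$ or $E_7^{(1)}$, $I=\{0,\dots,n\}$ ($n=6,7$), simple roots $\alpha_i$, coroots $h_i$, fundamental weights $\Lambda_i$, null root $\delta$, $\overline P=\bigoplus_i\mathbb Z\Lambda_i$ viewed as the quotient of the affine weight lattice by $\mathbb Z\delta$. Dynkin diagrams (Bourbaki): $E_6^{(1)}$: chain $1-3-4-5-6$ together with $4-2-0$; $E_7^{(1)}$: chain $0-1-3-4-5-6-7$ together with $4-2$. **Classical crystals.** A classical crystal is a set $B$ with maps $\tilde e_i,\tilde f_i:B\to B\sqcup\{0\}$, $\varepsilon_i,\varphi_i:B\to\mathbb Z\cup\{-\infty\}$ ($i\in I$) and $\mathrm{wt}:B\to\overline P$ such that $\varphi_i(b)-\varepsilon_i(b)=\langle h_i,\mathrm{wt}(b)\rangle$; if $\tilde e_ib\in B$ then $\mathrm{wt},\varepsilon_i,\varphi_i$ change by $+\alpha_i,-1,+1$; if $\tilde f_ib\in B$ they change by $-\alpha_i,+1,-1$; $\tilde f_ib=b'$ iff $b=\tilde e_ib'$; $\varphi_i(b)=-\infty$ implies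 $\tilde e_ib=\tilde f_ib=0$. An isomorphism is a bijection (extended by $0\mapsto0$) preserving $\mathrm{wt},\varepsilon_i,\varphi_i$ and commuting with all $\tilde e_i,\tilde f_i$. **$B_6,B_7$.** Here $\varpi_i=\Lambda_i-a_i^\vee\Lambda_0$ and $W(\varpi_i)$ is Kashiwara's level $0$ fundamental $U_q'(\hat{\mathfrak g})$-module. Concretely, $B_6$ (resp. $B_7$) has elements $b_\mu$, for $\mu\in\overline P$ in the finite Weyl group orbit of $\Lambda_1-\Lambda_0$ (resp. $\Lambda_7-\Lambda_0$), with $\mathrm{wt}(b_\mu)=\mu$, $\tilde f_ib_\mu=b_{\mu-\alpha_i}$ if $\langle h_i,\mu\rangle=1$ and $0$ otherwise, $\tilde e_ib_\mu=b_{\mu+\alpha_i}$ if $\langle h_i,\mu\rangle=-1$ and $0$ otherwise ($i\in I$), and $\varepsilon_i,\varphi_i$ the distances to the start and end of the $i$-string. **Young column patterns.** An infinite vertical strip of unit cubes indexed by $k\in\mathbb Z$ (height increasing with $k$), each cut by vertical cuts into blocks coloured by $I$. The horizontal cross-section of every cube is a grid with $w$ columns of cells (numbered $1,\dots,w$ from left to right) and two rows (upper, lower), $w=2$ for $E_6^{(1)}$ and $w=3$ for $E_7^{(1)}$. A block is the full-height prism over a union of cells. Write $u/l$ for a cross-section whose upper row has colours $u$ and lower row has colours $l$ (just $u$ if both rows agree); equally coloured cells of one cube form a single block. Rotation by $180^\circ$ sends $u/l$ to $\mathrm{rev}(l)/\mathrm{rev}(u)$, where rev reverses a word. - $E_6^{(1)}$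 (period 12): cubes $1,\dots,6$ are $44/04$; $25$; $46/44$; $35$; $44/14$; $32$; cube $k+6$ is the rotation of cube $k$ for all $k$. - $E_7^{(1)}$ (period 8): cubes $1,\dots,8$ are $332/032$; $144$; $355/335$; $446$; $257/255$; $446$; $355/335$; $144$. **Young columns.** A Young column is a nonempty collection of blocks of the pattern of bounded height with no empty space below any block: if a block of cube $k$ belongs to it, so does every block of cube $k-1$ lying below at least one of its cells. Young columns are equivalent if obtained from one another by vertical translation and/or rotation by $180^\circ$ about the vertical axis. An $i$-block of a Young column is removable if removing it leaves a Young column; an $i$-block not in it is addable if adding it gives a Young column. $\tilde f_i$ adds an addable $i$-block if one exists and gives $0$ otherwise; $\tilde e_i$ removes a removable $i$-block if one exists and gives $0$ otherwise; $\varphi_i(y)=\max\{m:\tilde f_i^my\ne0\}$, $\varepsilon_i(y)=\max\{m:\tilde e_i^my\ne0\}$. These descend to the set of equivalence classes, denoted $C_6$, $C_7$ in types $E_6^{(1)}$, $E_7^{(1)}$, which are classical crystals with $\mathrm{wt}(y)=\sum_i(\varphi_i(y)-\varepsilon_i(y))\Lambda_i$. *)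

theory Defs
  imports Main "HOL-Library.Extended" "HOL-Library.Function_Algebras"
begin

text \<open>Types E6(1) and E7(1), with nodes labelled as in Bourbaki; 0 is the affine node.\<close>

datatype affine_type = E6 | E7

fun index_set :: "affine_type \<Rightarrow> nat set" where
  "index_set E6 = {0..6}"
| "index_set E7 = {0..7}"

fun dynkin_edges :: "affine_type \<Rightarrow> nat set set" where
  "dynkin_edges E6 = {{1,3}, {3,4}, {4,5}, {5,6}, {4,2}, {2,0}}"
| "dynkin_edges E7 = {{0,1}, {1,3}, {3,4}, {4,5}, {5,6}, {6,7}, {4,2}}"

definition cartan :: "affine_type \<Rightarrow> nat \<Rightarrow> nat \<Rightarrow> int" where
  "cartan T i j = (if i = j then 2 else if {i, j} \<in> dynkin_edges T then -1 else 0)"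

text \<open>
  A classical weight is written in the basis of fundamental weights: the function \<open>\<nu>\<close>
  stands for the sum of all \<open>\<nu> i \<cdot> \<Lambda>\<^sub>i\<close>, so the pairing of \<open>h\<^sub>i\<close> with \<open>\<nu>\<close> is \<open>\<nu> i\<close>.
  Modulo the null root, \<open>\<alpha>\<^sub>i\<close> is determined by its pairings with the coroots.
\<close>

type_synonym weight = "nat \<Rightarrow> int"

definition weight_lattice :: "affine_type \<Rightarrow> weight set" where
  "weight_lattice T = {\<nu>. \<forall>i. i \<notin> index_set T \<longrightarrow> \<nu> i = 0}"

definition pairing :: "nat \<Rightarrow> weight \<Rightarrow> int" where
  "pairing i \<nu> = \<nu> i"

definition fund_weight :: "nat \<Rightarrow> weight" where
  "fund_weight i = (\<lambda>j. if j = i then 1 else 0)"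

definition simple_root :: "affine_type \<Rightarrow> nat \<Rightarrow> weight" where
  "simple_root T i = (\<lambda>j. if j \<in> index_set T then cartan T j i else 0)"

definition simple_reflection :: "affine_type \<Rightarrow> nat \<Rightarrow> weight \<Rightarrow> weight" where
  "simple_reflection T i \<nu> = (\<lambda>j. \<nu> j - pairing i \<nu> * simple_root T i j)"

inductive_set finite_weyl_group :: "affine_type \<Rightarrow> (weight \<Rightarrow> weight) set" for T where
  one: "id \<in> finite_weyl_group T"
| mult: "i \<in> index_set T - {0} \<Longrightarrow> w \<in> finite_weyl_group T
    \<Longrightarrow> simple_reflection T i \<circ> w \<in> finite_weyl_group T"

definition weyl_orbit :: "affine_type \<Rightarrow> weight \<Rightarrow> weight set" where
  "weyl_orbit T \<nu> = (\<lambda>w. w \<nu>) ` finite_weyl_group T"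

text \<open>
  The extra element \<open>0\<close> is \<^const>\<open>None\<close>. The values of \<open>\<epsilon>\<^sub>i\<close> and \<open>\<phi>\<^sub>i\<close> lie in the integers
  together with \<^term>\<open>Minf\<close>; the value \<^term>\<open>Pinf\<close> is excluded in the crystal axioms.
\<close>

record 'b crystal =
  elts :: "'b set"
  eop :: "nat \<Rightarrow> 'b \<Rightarrow> 'b option"
  fop :: "nat \<Rightarrow> 'b \<Rightarrow> 'b option"
  eps :: "nat \<Rightarrow> 'b \<Rightarrow> int extended"
  phi :: "nat \<Rightarrow> 'b \<Rightarrow> int extended"
  wt :: "'b \<Rightarrow> weight"

text \<open>
  Since \<open>Minf + Fin m = Minf\<close>, the first axiom below relating \<open>\<phi>\<^sub>i\<close> and \<open>\<epsilon>\<^sub>i\<close> makes both of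
  them \<open>Minf\<close> as soon as one of them is.
\<close>

definition classical_crystal :: "affine_type \<Rightarrow> 'b crystal \<Rightarrow> bool" where
  "classical_crystal T B \<longleftrightarrow>
    (\<forall>b \<in> elts B. wt B b \<in> weight_lattice T) \<and>
    (\<forall>i \<in> index_set T. \<forall>b \<in> elts B.
      eps B i b \<noteq> Pinf \<and> phi B i b \<noteq> Pinf \<and>
      phi B i b = eps B i b + Fin (pairing i (wt B b)) \<and>
      (\<forall>b'. eop B i b = Some b' \<longrightarrow>
        b' \<in> elts B \<and> wt B b' = wt B b + simple_root T i \<and>
        eps B i b' = eps B i b + Fin (-1) \<and> phi B i b' = phi B i b + Fin 1) \<and>
      (\<forall>b'. fop B i b = Some b' \<longrightarrow>
        b' \<in> elts B \<and> wt B b' = wt B b - simple_root T i \<and>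
        eps B i b' = eps B i b + Fin 1 \<and> phi B i b' = phi B i b + Fin (-1)) \<and>
      (\<forall>b' \<in> elts B. fop B i b = Some b' \<longleftrightarrow> eop B i b' = Some b) \<and>
      (phi B i b = Minf \<longrightarrow> eop B i b = None \<and> fop B i b = None))"

definition crystal_isomorphism ::
    "affine_type \<Rightarrow> 'b crystal \<Rightarrow> 'c crystal \<Rightarrow> ('b \<Rightarrow> 'c) \<Rightarrow> bool" where
  "crystal_isomorphism T B C \<psi> \<longleftrightarrow>
    classical_crystal T B \<and> classical_crystal T C \<and>
    bij_betw \<psi> (elts B) (elts C) \<and>
    (\<forall>b \<in> elts B. wt C (\<psi> b) = wt B b) \<and>
    (\<forall>i \<in> index_set T. \<forall>b \<in> elts B.
      eps C i (\<psi> b) = eps B i b \<and> phi C i (\<psi> b) = phi B i b \<and>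
      eop C i (\<psi> b) = map_option \<psi> (eop B i b) \<and>
      fop C i (\<psi> b) = map_option \<psi> (fop B i b))"

fun iterate_op :: "('b \<Rightarrow> 'b option) \<Rightarrow> nat \<Rightarrow> 'b \<Rightarrow> 'b option" where
  "iterate_op g 0 b = Some b"
| "iterate_op g (Suc m) b = Option.bind (iterate_op g m b) g"

definition string_length :: "('b \<Rightarrow> 'b option) \<Rightarrow> 'b \<Rightarrow> nat" where
  "string_length g b = Max {m. iterate_op g m b \<noteq> None}"

text \<open>
  The crystal bases of the level 0 fundamental representations \<open>W(\<Lambda>\<^sub>1 - \<Lambda>\<^sub>0)\<close> in type E6(1) and
  \<open>W(\<Lambda>\<^sub>7 - \<Lambda>\<^sub>0)\<close> in type E7(1) have one element \<open>b\<^sub>\<mu>\<close> for each weight \<open>\<mu>\<close> in the orbit of the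
  highest weight under the finite Weyl group. Here \<open>b\<^sub>\<mu>\<close> is represented by \<open>\<mu>\<close>.
\<close>

definition orbit_e :: "affine_type \<Rightarrow> nat \<Rightarrow> weight \<Rightarrow> weight option" where
  "orbit_e T i \<mu> = (if pairing i \<mu> = -1 then Some (\<mu> + simple_root T i) else None)"

definition orbit_f :: "affine_type \<Rightarrow> nat \<Rightarrow> weight \<Rightarrow> weight option" where
  "orbit_f T i \<mu> = (if pairing i \<mu> = 1 then Some (\<mu> - simple_root T i) else None)"

definition orbit_crystal :: "affine_type \<Rightarrow> weight \<Rightarrow> weight crystal" where
  "orbit_crystal T \<nu> =
    \<lparr> elts = weyl_orbit T \<nu>,
      eop = orbit_e T,
      fop = orbit_f T,
      eps = (\<lambda>i \<mu>. Fin (int (string_length (orbit_e T i) \<mu>))),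
      phi = (\<lambda>i \<mu>. Fin (int (string_length (orbit_f T i) \<mu>))),
      wt = (\<lambda>\<mu>. \<mu>) \<rparr>"

definition B6 :: "weight crystal" where
  "B6 = orbit_crystal E6 (fund_weight 1 - fund_weight 0)"

definition B7 :: "weight crystal" where
  "B7 = orbit_crystal E7 (fund_weight 7 - fund_weight 0)"

datatype row = Upper | Lower

type_synonym cell = "row \<times> nat"

text \<open>A cross-section \<open>u/l\<close> is the pair of the words \<open>u\<close> (upper row) and \<open>l\<close> (lower row).\<close>

type_synonym cross_section = "nat list \<times> nat list"

fun rotate_section :: "cross_section \<Rightarrow> cross_section" where
  "rotate_section (u, l) = (rev l, rev u)"

fun width :: "affine_type \<Rightarrow> nat" where
  "width E6 = 2"
| "width E7 = 3"

fun cube_list :: "affine_type \<Rightarrow> cross_section list" where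
  "cube_list E6 =
    [([4,4], [0,4]), ([2,5], [2,5]), ([4,6], [4,4]),
     ([3,5], [3,5]), ([4,4], [1,4]), ([3,2], [3,2])]"
| "cube_list E7 =
    [([3,3,2], [0,3,2]), ([1,4,4], [1,4,4]), ([3,5,5], [3,3,5]), ([4,4,6], [4,4,6]),
     ([2,5,7], [2,5,5]), ([4,4,6], [4,4,6]), ([3,5,5], [3,3,5]), ([1,4,4], [1,4,4])]"

fun cube :: "affine_type \<Rightarrow> int \<Rightarrow> cross_section" where
  "cube E6 k =
    (let s = cube_list E6 ! nat ((k - 1) mod 6)
     in if even ((k - 1) div 6) then s else rotate_section s)"
| "cube E7 k = cube_list E7 ! nat ((k - 1) mod 8)"

definition cells :: "affine_type \<Rightarrow> cell set" where
  "cells T = UNIV \<times> {1..width T}"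

fun colour :: "affine_type \<Rightarrow> int \<Rightarrow> cell \<Rightarrow> nat" where
  "colour T k (Upper, c) = fst (cube T k) ! (c - 1)"
| "colour T k (Lower, c) = snd (cube T k) ! (c - 1)"

text \<open>
  Equally coloured cells of one cube form a single block, so a block is given by the index
  of its cube and its colour.
\<close>

type_synonym block = "int \<times> nat"

fun footprint :: "affine_type \<Rightarrow> block \<Rightarrow> cell set" where
  "footprint T (k, i) = {p \<in> cells T. colour T k p = i}"

definition blocks :: "affine_type \<Rightarrow> block set" where
  "blocks T = {b. footprint T b \<noteq> {}}"

definition young_column :: "affine_type \<Rightarrow> block set \<Rightarrow> bool" where
  "young_column T Y \<longleftrightarrow>
    Y \<noteq> {} \<and> Y \<subseteq> blocks T \<and>
    (\<exists>K. \<forall>(k, i) \<in> Y. k \<le> K) \<and>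
    (\<forall>k i j. (k, i) \<in> Y \<longrightarrow> (k - 1, j) \<in> blocks T \<longrightarrow>
      footprint T (k, i) \<inter> footprint T (k - 1, j) \<noteq> {} \<longrightarrow> (k - 1, j) \<in> Y)"

text \<open>
  Equivalence is geometric: a vertical translation, possibly composed with the rotation by
  180 degrees about the vertical axis, carries one coloured solid to the other. As a Young
  column contains every block that is low enough, such a motion is a symmetry of the pattern.
\<close>

definition solid :: "affine_type \<Rightarrow> block set \<Rightarrow> ((int \<times> cell) \<times> nat) set" where
  "solid T Y = {((k, p), i) | k p i. (k, i) \<in> Y \<and> p \<in> footprint T (k, i)}"

fun rotate_cell :: "affine_type \<Rightarrow> cell \<Rightarrow> cell" where
  "rotate_cell T (Upper, c) = (Lower, width T + 1 - c)"
| "rotate_cell T (Lower, c) = (Upper, width T + 1 - c)"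

definition move ::
    "affine_type \<Rightarrow> int \<Rightarrow> bool \<Rightarrow> (int \<times> cell) \<times> nat \<Rightarrow> (int \<times> cell) \<times> nat" where
  "move T t r = (\<lambda>((k, p), i). ((k + t, if r then rotate_cell T p else p), i))"

definition young_equiv :: "affine_type \<Rightarrow> (block set \<times> block set) set" where
  "young_equiv T = {(Y, Y'). young_column T Y \<and> young_column T Y' \<and>
    (\<exists>t r. move T t r ` solid T Y = solid T Y')}"

definition addable :: "affine_type \<Rightarrow> nat \<Rightarrow> block set \<Rightarrow> block \<Rightarrow> bool" where
  "addable T i Y b \<longleftrightarrow> b \<in> blocks T \<and> snd b = i \<and> b \<notin> Y \<and> young_column T (insert b Y)"

definition removable :: "affine_type \<Rightarrow> nat \<Rightarrow> block set \<Rightarrow> block \<Rightarrow> bool" where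
  "removable T i Y b \<longleftrightarrow> snd b = i \<and> b \<in> Y \<and> young_column T (Y - {b})"

definition column_f :: "affine_type \<Rightarrow> nat \<Rightarrow> block set \<Rightarrow> block set option" where
  "column_f T i Y =
    (if \<exists>b. addable T i Y b then Some (insert (SOME b. addable T i Y b) Y) else None)"

definition column_e :: "affine_type \<Rightarrow> nat \<Rightarrow> block set \<Rightarrow> block set option" where
  "column_e T i Y =
    (if \<exists>b. removable T i Y b then Some (Y - {SOME b. removable T i Y b}) else None)"

definition column_phi :: "affine_type \<Rightarrow> nat \<Rightarrow> block set \<Rightarrow> int" where
  "column_phi T i Y = int (string_length (column_f T i) Y)"

definition column_eps :: "affine_type \<Rightarrow> nat \<Rightarrow> block set \<Rightarrow> int" where
  "column_eps T i Y = int (string_length (column_e T i) Y)"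

definition column_wt :: "affine_type \<Rightarrow> block set \<Rightarrow> weight" where
  "column_wt T Y = (\<lambda>i. if i \<in> index_set T then column_phi T i Y - column_eps T i Y else 0)"

definition young_class :: "affine_type \<Rightarrow> block set \<Rightarrow> block set set" where
  "young_class T Y = young_equiv T `` {Y}"

text \<open>
  Each map on Young columns descends to classes by \<^const>\<open>the_elem\<close>, which has a specified value
  only if all members of the class give the same result.
\<close>

definition young_crystal :: "affine_type \<Rightarrow> block set set crystal" where
  "young_crystal T =
    \<lparr> elts = {Y. young_column T Y} // young_equiv T,
      eop = (\<lambda>i X. the_elem ((\<lambda>Y. map_option (young_class T) (column_e T i Y)) ` X)),
      fop = (\<lambda>i X. the_elem ((\<lambda>Y. map_option (young_class T) (column_f T i Y)) ` X)),
      eps = (\<lambda>i X. Fin (the_elem (column_eps T i ` X))),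
      phi = (\<lambda>i X. Fin (the_elem (column_phi T i ` X))),
      wt = (\<lambda>X. the_elem (column_wt T ` X)) \<rparr>"

definition C6 :: "block set set crystal" where
  "C6 = young_crystal E6"

definition C7 :: "block set set crystal" where
  "C7 = young_crystal E7"

end

theory Submission
  imports Defs
begin

text \<open>
  A block of colour \<open>i\<close> rests on a block of colour \<open>j\<close> in the cube below exactly when \<open>i\<close> and \<open>j\<close> are
  adjacent in the Dynkin diagram, and between two consecutive \<open>i\<close>-blocks there are exactly two
  blocks of adjacent colours: the pattern is a full heap, and Young columns are its proper ideals.
  Hence \<open>\<langle>h\<^sub>i, wt Y\<rangle>\<close> is one less than the number of blocks of \<open>Y\<close> of colours adjacent to \<open>i\<close> above
  the top \<open>i\<close>-block; it lies in \<open>{-1, 0, 1}\<close>, and adding an \<open>i\<close>-block subtracts \<open>\<alpha>\<^sub>i\<close> from the weight.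
  Since the colour 0 occurs once per period, equivalence is translation by multiples of the period
  (combined in type E6 with the rotation), and every column can be moved so that its top 0-block lies
  in cube 1. Such a column is reduced to the least column containing that block by removing blocks
  of nonzero colours, each of which is detected by a pairing \<open>-1\<close>. So the weight determines the class,
  and the weights that occur form the orbit of the weight of the least column under the finite
  Weyl group.
\<close>

section \<open>Short strings, greatest elements and transport of the crystal axioms\<close>

abbreviation adj :: "affine_type \<Rightarrow> nat \<Rightarrow> nat \<Rightarrow> bool" where
  "adj T i j \<equiv> {i, j} \<in> dynkin_edges T"

lemma adj_commute: "adj T i j \<longleftrightarrow> adj T j i"
  by (simp add: insert_commute)

text \<open>\<open>None\<close> is absorbing under \<open>iterate_op\<close>, so once the second
  application fails all later ones do, and the set under \<open>Max\<close> is \<open>{0}\<close> or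
  \<open>{0, 1}\<close>. Its finiteness matters, as \<open>Max\<close> is unspecified on infinite
  sets.\<close>

lemma string_length_le_1:
  assumes "\<And>b'. g b = Some b' \<Longrightarrow> g b' = None"
  shows "string_length g b = (if g b = None then 0 else 1)"
proof -
  have none: "iterate_op g (Suc (Suc m)) b = None" for m
    by (induction m) (use assms in \<open>auto split: Option.bind_split\<close>)
  have "{m. iterate_op g m b \<noteq> None} = (if g b = None then {0} else {0, 1})"
  proof (rule set_eqI)
    fix m
    show "m \<in> {m. iterate_op g m b \<noteq> None} \<longleftrightarrow> m \<in> (if g b = None then {0} else {0, 1})"
    proof (cases m)
      case (Suc m')
      then show ?thesis using none by (cases m') auto
    qed simp
  qed
  then show ?thesis by (simp add: string_length_def)
qed

lemma int_set_has_greatest: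
  fixes S :: "int set"
  assumes "a \<in> S" and "\<And>x. x \<in> S \<Longrightarrow> x \<le> K"
  obtains m where "m \<in> S" and "\<And>x. x \<in> S \<Longrightarrow> x \<le> m"
proof -
  define m where "m = Max (S \<inter> {a..K})"
  have fin: "finite (S \<inter> {a..K})" and ne: "S \<inter> {a..K} \<noteq> {}"
    using assms by auto
  have "m \<in> S" using Max_in[OF fin ne] by (simp add: m_def)
  moreover have "x \<le> m" if "x \<in> S" for x
  proof (cases "a \<le> x")
    case True
    then show ?thesis using that assms(2) fin by (simp add: m_def)
  next
    case False
    moreover have "a \<le> m" using assms fin by (auto simp: m_def)
    ultimately show ?thesis by simp
  qed
  ultimately show ?thesis using that by blast
qed

text \<open>Lets the axioms be checked on the orbit side, where elements are explicit weights; the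
  operators on classes, defined through \<open>the_elem\<close>, inherit them. Injectivity of \<psi>
  carries over the axiom that \<open>fop\<close> and \<open>eop\<close> are mutually
  inverse.\<close>

lemma classical_crystal_transfer:
  assumes B: "classical_crystal T B"
    and bij: "bij_betw \<psi> (elts B) (elts C)"
    and wt: "\<And>b. b \<in> elts B \<Longrightarrow> wt C (\<psi> b) = wt B b"
    and eps: "\<And>i b. i \<in> index_set T \<Longrightarrow> b \<in> elts B \<Longrightarrow> eps C i (\<psi> b) = eps B i b"
    and phi: "\<And>i b. i \<in> index_set T \<Longrightarrow> b \<in> elts B \<Longrightarrow> phi C i (\<psi> b) = phi B i b"
    and e: "\<And>i b. i \<in> index_set T \<Longrightarrow> b \<in> elts B \<Longrightarrow> eop C i (\<psi> b) = map_option \<psi> (eop B i b)"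
    and f: "\<And>i b. i \<in> index_set T \<Longrightarrow> b \<in> elts B \<Longrightarrow> fop C i (\<psi> b) = map_option \<psi> (fop B i b)"
  shows "crystal_isomorphism T B C \<psi>"
proof -
  have img: "elts C = \<psi> ` elts B" and inj: "inj_on \<psi> (elts B)"
    using bij by (auto simp: bij_betw_def)
  have ax: "eps B i b \<noteq> Pinf" "phi B i b \<noteq> Pinf"
      "phi B i b = eps B i b + Fin (pairing i (wt B b))"
      "\<And>b'. eop B i b = Some b' \<Longrightarrow> b' \<in> elts B \<and> wt B b' = wt B b + simple_root T i \<and>
        eps B i b' = eps B i b + Fin (-1) \<and> phi B i b' = phi B i b + Fin 1"
      "\<And>b'. fop B i b = Some b' \<Longrightarrow> b' \<in> elts B \<and> wt B b' = wt B b - simple_root T i \<and>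
        eps B i b' = eps B i b + Fin 1 \<and> phi B i b' = phi B i b + Fin (-1)"
      "\<And>b'. b' \<in> elts B \<Longrightarrow> fop B i b = Some b' \<longleftrightarrow> eop B i b' = Some b"
      "phi B i b = Minf \<Longrightarrow> eop B i b = None \<and> fop B i b = None"
    if "i \<in> index_set T" "b \<in> elts B" for i b
    using B that unfolding classical_crystal_def by blast+
  have "classical_crystal T C"
    unfolding classical_crystal_def img
  proof (intro conjI ballI)
    fix c assume "c \<in> \<psi> ` elts B"
    then show "wt C c \<in> weight_lattice T"
      using B wt unfolding classical_crystal_def by auto
  next
    fix i c assume i: "i \<in> index_set T" and "c \<in> \<psi> ` elts B"
    then obtain b where b: "b \<in> elts B" "c = \<psi> b" by blast
    note ax' = ax[OF i b(1)]
    note tr = wt[OF b(1)] eps[OF i b(1)] phi[OF i b(1)] e[OF i b(1)] f[OF i b(1)]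
    show "eps C i c \<noteq> Pinf" "phi C i c \<noteq> Pinf"
      "phi C i c = eps C i c + Fin (pairing i (wt C c))"
      using ax'(1-3) by (simp_all add: b(2) tr)
    show "\<forall>c'. eop C i c = Some c' \<longrightarrow>
        c' \<in> \<psi> ` elts B \<and> wt C c' = wt C c + simple_root T i \<and>
        eps C i c' = eps C i c + Fin (-1) \<and> phi C i c' = phi C i c + Fin 1"
      using ax'(4) wt eps[OF i] phi[OF i] unfolding b(2) tr by auto
    show "\<forall>c'. fop C i c = Some c' \<longrightarrow>
        c' \<in> \<psi> ` elts B \<and> wt C c' = wt C c - simple_root T i \<and>
        eps C i c' = eps C i c + Fin 1 \<and> phi C i c' = phi C i c + Fin (-1)"
      using ax'(5) wt eps[OF i] phi[OF i] unfolding b(2) tr by auto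
    show "phi C i c = Minf \<longrightarrow> eop C i c = None \<and> fop C i c = None"
      using ax'(7) by (auto simp: b(2) tr)
    fix c' assume "c' \<in> \<psi> ` elts B"
    then obtain b' where b': "b' \<in> elts B" "c' = \<psi> b'" by blast
    have "fop C i c = Some c' \<longleftrightarrow> fop B i b = Some b'"
      using ax'(5) inj b b' by (auto simp: tr inj_on_def)
    moreover have "eop C i c' = Some c \<longleftrightarrow> eop B i b' = Some b"
      using ax(4)[OF i b'(1)] inj b b' by (auto simp: e[OF i b'(1)] inj_on_def)
    ultimately show "fop C i c = Some c' \<longleftrightarrow> eop C i c' = Some c"
      using ax'(6)[OF b'(1)] by simp
  qed
  then show ?thesis
    using assms unfolding crystal_isomorphism_def by blast
qed

section \<open>Translated columns and top blocks\<close>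

definition shift :: "int \<Rightarrow> block set \<Rightarrow> block set" where
  "shift n Y = (\<lambda>(k, i). (k + n, i)) ` Y"

lemma mem_shift [simp]: "(k, i) \<in> shift n Y \<longleftrightarrow> (k - n, i) \<in> Y"
  unfolding shift_def by (force simp: image_iff)

lemma shift_0 [simp]: "shift 0 Y = Y"
  by auto

lemma shift_shift [simp]: "shift m (shift n Y) = shift (n + m) Y"
  by (auto simp: algebra_simps)

lemma shift_insert: "shift n (insert (k, i) Y) = insert (k + n, i) (shift n Y)"
  by (auto simp: algebra_simps)

lemma shift_Diff: "shift n (Y - {(k, i)}) = shift n Y - {(k + n, i)}"
  by (auto simp: algebra_simps)

lemma mem_solid: "((k, p), i) \<in> solid T Y \<longleftrightarrow> (k, i) \<in> Y \<and> p \<in> footprint T (k, i)"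
  unfolding solid_def by blast

definition is_top :: "block set \<Rightarrow> nat \<Rightarrow> int \<Rightarrow> bool" where
  "is_top Y i k \<longleftrightarrow> (k, i) \<in> Y \<and> (\<forall>l>k. (l, i) \<notin> Y)"

section \<open>Full heaps\<close>

text \<open>The flag \<open>r\<close> in \<open>symmetry\<close> may vary with \<open>n\<close> but
  not with the cube or the colour, so one rigid motion realises each translation. In
  \<open>next_block\<close> the two neighbours lie in the same cube or have the same colour; in the
  second case the upper one forces the lower one into a column.\<close>

locale full_heap =
  fixes T :: affine_type and P :: int
  assumes P_pos: "0 < P"
    and block_colour: "(k, i) \<in> blocks T \<Longrightarrow> i \<in> index_set T"
    and colour_occurs: "i \<in> index_set T \<Longrightarrow> \<exists>k. (k, i) \<in> blocks T"
    and connected: "S \<subseteq> index_set T \<Longrightarrow> S \<noteq> {} \<Longrightarrow>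
      (\<And>i j. i \<in> S \<Longrightarrow> adj T i j \<Longrightarrow> j \<in> S) \<Longrightarrow> S = index_set T"
    and adj_index: "adj T i j \<Longrightarrow> j \<in> index_set T"
    and symmetry: "\<exists>r. \<forall>k i. footprint T (k + n * P, i) =
      (if r then rotate_cell T else id) ` footprint T (k, i)"
    and cover: "(k, i) \<in> blocks T \<Longrightarrow> (k - 1, j) \<in> blocks T \<Longrightarrow>
      footprint T (k, i) \<inter> footprint T (k - 1, j) \<noteq> {} \<longleftrightarrow> adj T i j"
    and next_block: "(k, i) \<in> blocks T \<Longrightarrow> \<exists>u j j'. k + 1 < u \<and> (u, i) \<in> blocks T \<and>
      (\<forall>l. k < l \<longrightarrow> l < u \<longrightarrow> (l, i) \<notin> blocks T) \<and>
      (\<forall>l m. k < l \<and> l < u \<and> adj T i m \<and> (l, m) \<in> blocks T \<longleftrightarrow>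
        (l, m) \<in> {(k + 1, j), (u - 1, j')}) \<and>
      (k + 1, j) \<noteq> (u - 1, j') \<and> (u = k + 2 \<or> j = j')"
    and level: "adj T i j \<Longrightarrow> (k, i) \<in> blocks T \<Longrightarrow> (k, j) \<notin> blocks T"
    and zero_block: "(k, 0) \<in> blocks T \<longleftrightarrow> P dvd k - 1"
    and zero_index: "0 \<in> index_set T"
begin

abbreviation "H \<equiv> blocks T"

lemma adj_irrefl: "i \<in> index_set T \<Longrightarrow> \<not> adj T i i"
  using colour_occurs level by blast

lemma finite_index: "finite (index_set T)"
  by (cases T) auto

section \<open>Columns as ideals of the heap\<close>

lemma young_column_iff:
  "young_column T Y \<longleftrightarrow> Y \<noteq> {} \<and> Y \<subseteq> H \<and> (\<exists>K. \<forall>k i. (k, i) \<in> Y \<longrightarrow> k \<le> K) \<and>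
    (\<forall>k i j. (k, i) \<in> Y \<longrightarrow> (k - 1, j) \<in> H \<longrightarrow> adj T i j \<longrightarrow> (k - 1, j) \<in> Y)"
proof -
  have "(\<forall>k i j. (k, i) \<in> Y \<longrightarrow> (k - 1, j) \<in> H \<longrightarrow>
      footprint T (k, i) \<inter> footprint T (k - 1, j) \<noteq> {} \<longrightarrow> (k - 1, j) \<in> Y) \<longleftrightarrow>
    (\<forall>k i j. (k, i) \<in> Y \<longrightarrow> (k - 1, j) \<in> H \<longrightarrow> adj T i j \<longrightarrow> (k - 1, j) \<in> Y)"
    if "Y \<subseteq> H"
    using cover that by (meson subsetD)
  moreover have "(\<exists>K. \<forall>(k, i) \<in> Y. k \<le> K) \<longleftrightarrow> (\<exists>K. \<forall>k i. (k, i) \<in> Y \<longrightarrow> k \<le> K)"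
    by (simp add: Ball_def split_paired_All)
  ultimately show ?thesis unfolding young_column_def by blast
qed

lemma young_columnI:
  assumes "Y \<noteq> {}" "Y \<subseteq> H" "\<And>k i. (k, i) \<in> Y \<Longrightarrow> k \<le> K"
    "\<And>k i j. (k, i) \<in> Y \<Longrightarrow> (k - 1, j) \<in> H \<Longrightarrow> adj T i j \<Longrightarrow> (k - 1, j) \<in> Y"
  shows "young_column T Y"
  unfolding young_column_iff using assms by blast

lemma young_column_subset: "young_column T Y \<Longrightarrow> b \<in> Y \<Longrightarrow> b \<in> H"
  by (auto simp: young_column_iff)

lemma young_column_bound:
  assumes "young_column T Y"
  obtains K where "\<And>k i. (k, i) \<in> Y \<Longrightarrow> k \<le> K"
  using assms unfolding young_column_iff by blast

lemma young_column_closed: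
  "young_column T Y \<Longrightarrow> (k, i) \<in> Y \<Longrightarrow> (k - 1, j) \<in> H \<Longrightarrow> adj T i j \<Longrightarrow> (k - 1, j) \<in> Y"
  by (auto simp: young_column_iff)

lemma period: "(k + n * P, i) \<in> H \<longleftrightarrow> (k, i) \<in> H"
proof -
  obtain r where "\<forall>k i. footprint T (k + n * P, i) =
      (if r then rotate_cell T else id) ` footprint T (k, i)"
    using symmetry by blast
  then have "footprint T (k + n * P, i) = {} \<longleftrightarrow> footprint T (k, i) = {}"
    by simp
  then show ?thesis by (simp add: blocks_def)
qed

lemma block_below:
  assumes "i \<in> index_set T"
  obtains l where "l < k" "(l, i) \<in> H"
proof -
  obtain k0 where k0: "(k0, i) \<in> H" using colour_occurs assms by blast
  \<comment> \<open>As \<open>P\<close> is at least 1, descending \<open>|k0 - k| + 1\<close>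
    periods from \<open>k0\<close> leads below \<open>k\<close>.\<close>
  let ?l = "k0 + (- \<bar>k0 - k\<bar> - 1) * P"
  have "\<bar>k0 - k\<bar> + 1 \<le> (\<bar>k0 - k\<bar> + 1) * P"
    using P_pos mult_le_cancel_left1[of "\<bar>k0 - k\<bar> + 1" P] by auto
  then have "?l < k" by (simp add: algebra_simps)
  then show ?thesis using that period k0 by blast
qed

text \<open>The mirror image of \<open>next_block\<close>, obtained by applying it to the greatest
  \<open>i\<close>-block below \<open>u\<close>: no \<open>i\<close>-block lies strictly between the
  two, so the next one is \<open>u\<close>.\<close>

lemma previous_block:
  assumes u: "(u, i) \<in> H"
  obtains k j j' where "k + 1 < u" "(k, i) \<in> H" 
    "\<And>l. k < l \<Longrightarrow> l < u \<Longrightarrow> (l, i) \<notin> H"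
    "\<And>l m. k < l \<and> l < u \<and> adj T i m \<and> (l, m) \<in> H \<longleftrightarrow> (l, m) \<in> {(k + 1, j), (u - 1, j')}"
    "(k + 1, j) \<noteq> (u - 1, j')" "u = k + 2 \<or> j = j'"
proof -
  obtain l where l: "l < u" "(l, i) \<in> H"
    using block_below block_colour[OF u] by blast
  then obtain k where k: "k < u" "(k, i) \<in> H"
    and max: "\<And>l. l < u \<Longrightarrow> (l, i) \<in> H \<Longrightarrow> l \<le> k"
    using int_set_has_greatest[of l "{l. l < u \<and> (l, i) \<in> H}" u]
    by (metis (no_types, lifting) less_imp_le mem_Collect_eq)
  obtain u' j j' where u': "k + 1 < u'" "(u', i) \<in> H"
      "\<forall>l. k < l \<longrightarrow> l < u' \<longrightarrow> (l, i) \<notin> H"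
      "\<forall>l m. k < l \<and> l < u' \<and> adj T i m \<and> (l, m) \<in> H \<longleftrightarrow> (l, m) \<in> {(k + 1, j), (u' - 1, j')}"
      "(k + 1, j) \<noteq> (u' - 1, j') \<and> (u' = k + 2 \<or> j = j')"
    using next_block[OF k(2)] by blast
  have "u' = u"
  proof (rule linorder_cases)
    assume "u' < u" then show ?thesis using max[of u'] u' by auto
  next
    assume "u < u'" then show ?thesis using u' k u by auto
  qed
  then show ?thesis using that[of k j j'] u' k by blast
qed

text \<open>Closure under blocks directly below propagates down any distance between equal or
  adjacent colours. The induction on the height difference descends through the neighbour
  \<open>(k - 1, y)\<close> just below \<open>(k, i)\<close>.\<close>

lemma young_column_below:
  assumes Y: "young_column T Y"
  shows "(k, i) \<in> Y \<Longrightarrow> (l, j) \<in> H \<Longrightarrow> l < k \<Longrightarrow> i = j \<or> adj T i j \<Longrightarrow> (l, j) \<in> Y"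
proof (induction "nat (k - l)" arbitrary: k i l j rule: less_induct)
  case less
  have kH: "(k, i) \<in> H" using young_column_subset Y less.prems by blast
  obtain p x y where p: "p + 1 < k" "(p, i) \<in> H" "\<And>l. p < l \<Longrightarrow> l < k \<Longrightarrow> (l, i) \<notin> H"
    and nb: "\<And>l m. p < l \<and> l < k \<and> adj T i m \<and> (l, m) \<in> H \<longleftrightarrow> (l, m) \<in> {(p + 1, x), (k - 1, y)}"
    and xy: "(p + 1, x) \<noteq> (k - 1, y)" "k = p + 2 \<or> x = y"
    using previous_block[OF kH] by blast
  have y: "adj T i y" "(k - 1, y) \<in> H" using nb[of "k - 1" y] by auto
  have yY: "(k - 1, y) \<in> Y" using young_column_closed[OF Y less.prems(1) y(2) y(1)] .
  have step: "(l', j') \<in> Y" if "(k', i') \<in> Y" "(l', j') \<in> H" "l' < k'" "k' < k" "l \<le> l'"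
      "i' = j' \<or> adj T i' j'" for k' i' l' j'
    using less.hyps[of k' l' i' j'] that by auto
  show ?case
  proof (cases "i = j")
    case True
    then have "l \<le> p" using p(3)[of l] less.prems by force
    then show ?thesis using step[OF yY] y p(1) adj_commute True less.prems by auto
  next
    case False
    then have ij: "adj T i j" using less.prems by blast
    consider "l = k - 1" | "l < k - 1" "p < l" | "l = p" | "l < p" using less.prems by linarith
    then show ?thesis
    proof cases
      case 1
      then show ?thesis using young_column_closed[OF Y less.prems(1)] ij less.prems by blast
    next
      case 2
      then have "(l, j) \<in> {(p + 1, x), (k - 1, y)}" using nb[of l j] ij less.prems by blast
      \<comment> \<open>In the gap but not in cube \<open>k - 1\<close>, the block is the lower
        neighbour; the neighbours then lie in different cubes and share their colour.\<close>
      then have "j = y" using 2 xy by auto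
      then show ?thesis using step[OF yY] 2 less.prems by auto
    next
      case 3
      then show ?thesis using level[OF ij p(2)] less.prems by blast
    next
      case 4
      \<comment> \<open>Below the previous \<open>i\<close>-block, the descent pauses at that block
        and starts again from it.\<close>
      then have "(p, i) \<in> Y" using step[OF yY p(2)] y adj_commute p(1) by auto
      then show ?thesis using step[of p i l j] 4 p(1) ij less.prems by auto
    qed
  qed
qed

lemma young_column_all_colours:
  assumes Y: "young_column T Y" and "i \<in> index_set T"
  obtains k where "(k, i) \<in> Y"
proof -
  \<comment> \<open>The colours occurring in \<open>Y\<close> are closed under adjacency, so the
    connected diagram contributes all its nodes.\<close>
  have "{i. \<exists>k. (k, i) \<in> Y} = index_set T"
  proof (rule connected)
    show "{i. \<exists>k. (k, i) \<in> Y} \<subseteq> index_set T"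
      using young_column_subset[OF Y] block_colour by blast
    show "{i. \<exists>k. (k, i) \<in> Y} \<noteq> {}"
      using Y unfolding young_column_iff by auto
    fix i j assume "i \<in> {i. \<exists>k. (k, i) \<in> Y}" and ij: "adj T i j"
    then obtain k where k: "(k, i) \<in> Y" by blast
    obtain l where "l < k" "(l, j) \<in> H" using block_below adj_index[OF ij] by blast
    then show "j \<in> {i. \<exists>k. (k, i) \<in> Y}" using young_column_below[OF Y k] ij by blast
  qed
  then show ?thesis using assms that by blast
qed

lemma top_exists:
  assumes Y: "young_column T Y" and "i \<in> index_set T"
  obtains k where "is_top Y i k"
proof -
  obtain k0 where k0: "(k0, i) \<in> Y" using young_column_all_colours assms by blast
  obtain K where "\<And>k i. (k, i) \<in> Y \<Longrightarrow> k \<le> K" using young_column_bound[OF Y] by blast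
  then obtain m where "(m, i) \<in> Y" "\<And>x. (x, i) \<in> Y \<Longrightarrow> x \<le> m"
    using int_set_has_greatest[of k0 "{k. (k, i) \<in> Y}" K] k0
    by (metis (no_types, lifting) mem_Collect_eq)
  then show ?thesis using that by (force simp: is_top_def)
qed

lemma is_top_mem_iff:
  assumes "young_column T Y" "is_top Y i k"
  shows "(l, i) \<in> Y \<longleftrightarrow> (l, i) \<in> H \<and> l \<le> k"
  using assms young_column_subset young_column_below[of Y k i l i]
  unfolding is_top_def by (metis linorder_not_less order_le_less)

lemma is_top_unique: "is_top Y i k \<Longrightarrow> is_top Y i l \<Longrightarrow> k = l"
  unfolding is_top_def by (meson linorder_neqE)

text \<open>
  Here \<open>k\<close> and \<open>u\<close> are the cubes of the top \<open>i\<close>-block and of the next one, and \<open>a\<close>, \<open>b\<close> are the two blocks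
  of adjacent colours between them.
\<close>

lemma top_neighbours:
  assumes Y: "young_column T Y" and i: "i \<in> index_set T"
  obtains k u a b where "is_top Y i k" "k < u" "(u, i) \<in> H" "a \<noteq> b"
    "\<And>c. addable T i Y c \<longleftrightarrow> c = (u, i) \<and> a \<in> Y \<and> b \<in> Y"
    "\<And>c. removable T i Y c \<longleftrightarrow> c = (k, i) \<and> a \<notin> Y \<and> b \<notin> Y"
    "{(l, j) \<in> Y. adj T i j \<and> k < l} = {a, b} \<inter> Y"
proof -
  obtain k where k: "is_top Y i k" using top_exists assms by blast
  have kY: "(k, i) \<in> Y" and kH: "(k, i) \<in> H"
    using k young_column_subset[OF Y] by (auto simp: is_top_def)
  obtain u x y where u: "k + 1 < u" "(u, i) \<in> H" "\<And>l. k < l \<Longrightarrow> l < u \<Longrightarrow> (l, i) \<notin> H"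
    and nb: "\<And>l m. k < l \<and> l < u \<and> adj T i m \<and> (l, m) \<in> H \<longleftrightarrow> (l, m) \<in> {(k + 1, x), (u - 1, y)}"
    and xy: "(k + 1, x) \<noteq> (u - 1, y)"
    using next_block[OF kH] by blast
  have uY: "(u, i) \<notin> Y" using k u(1) by (auto simp: is_top_def)
  have x: "adj T i x" "(k + 1, x) \<in> H" and y: "adj T i y" "(u - 1, y) \<in> H"
    using nb[of "u - 1" y] nb[of "k + 1" x] by auto
  \<comment> \<open>A block of adjacent colour above \<open>(u, i)\<close> would force
    \<open>(u, i)\<close> into \<open>Y\<close>; hence only the two neighbours in the gap can lie
    above the top \<open>i\<close>-block.\<close>
  have above: "l < u" if "(l, j) \<in> Y" "adj T i j" for l j
  proof (rule ccontr)
    assume "\<not> l < u"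
    moreover have "l \<noteq> u" using level[OF that(2) u(2)] young_column_subset[OF Y that(1)] by blast
    ultimately have "(u, i) \<in> Y"
      using young_column_below[OF Y that(1) u(2)] that(2) adj_commute by auto
    then show False using uY by blast
  qed
  have set: "{(l, j) \<in> Y. adj T i j \<and> k < l} = {(k + 1, x), (u - 1, y)} \<inter> Y"
    (is "?L = ?R")
  proof (rule set_eqI)
    fix c :: block
    obtain l j where c: "c = (l, j)" by (cases c)
    show "c \<in> ?L \<longleftrightarrow> c \<in> ?R"
      unfolding c using nb[of l j] above[of l j] young_column_subset[OF Y, of "(l, j)"] by blast
  qed
  have add: "addable T i Y c \<longleftrightarrow> c = (u, i) \<and> (k + 1, x) \<in> Y \<and> (u - 1, y) \<in> Y" for c
  proof
    assume *: "addable T i Y c"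
    then obtain l where c: "c = (l, i)" by (cases c) (auto simp: addable_def)
    have lY: "(l, i) \<in> H" "(l, i) \<notin> Y" "young_column T (insert (l, i) Y)"
      using * by (auto simp: addable_def c)
    have "k < l" using is_top_mem_iff[OF Y k] lY by force
    \<comment> \<open>An \<open>i\<close>-block above \<open>u\<close> cannot be added while
      \<open>(u, i)\<close> is missing.\<close>
    have "l = u"
    proof (rule ccontr)
      assume "l \<noteq> u"
      then have "u < l" using u(3)[of l] \<open>k < l\<close> lY(1) by force
      then show False using young_column_below[OF lY(3) _ u(2), of l i] uY by auto
    qed
    moreover have "(k + 1, x) \<in> Y" "(u - 1, y) \<in> Y"
      using young_column_below[OF lY(3), of l i] x y u(1) adj_irrefl[OF i] \<open>l = u\<close> by auto
    ultimately show "c = (u, i) \<and> (k + 1, x) \<in> Y \<and> (u - 1, y) \<in> Y" using c by blast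
  next
    assume *: "c = (u, i) \<and> (k + 1, x) \<in> Y \<and> (u - 1, y) \<in> Y"
    obtain K where K: "\<And>k i. (k, i) \<in> Y \<Longrightarrow> k \<le> K" using young_column_bound[OF Y] by blast
    have "young_column T (insert (u, i) Y)"
    proof (rule young_columnI)
      show "insert (u, i) Y \<subseteq> H" using u(2) young_column_subset[OF Y] by blast
      show "l \<le> max u K" if "(l, j) \<in> insert (u, i) Y" for l j
        using that K[of l j] by auto
      show "(l - 1, m) \<in> insert (u, i) Y"
        if "(l, j) \<in> insert (u, i) Y" "(l - 1, m) \<in> H" "adj T j m" for l j m
      proof (cases "(l, j) \<in> Y")
        case True
        then show ?thesis using that young_column_closed[OF Y, of l j m] by blast
      next
        case False
        then have "l = u" "j = i" using that by auto
        then have "(l - 1, m) \<in> {(k + 1, x), (u - 1, y)}" using nb[of "l - 1" m] u(1) that by auto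
        then show ?thesis using * by (metis insert_iff empty_iff)
      qed
    qed simp
    then show "addable T i Y c" using * u uY by (auto simp: addable_def)
  qed
  have rem: "removable T i Y c \<longleftrightarrow> c = (k, i) \<and> (k + 1, x) \<notin> Y \<and> (u - 1, y) \<notin> Y" for c
  proof
    assume *: "removable T i Y c"
    then obtain l where c: "c = (l, i)" by (cases c) (auto simp: removable_def)
    have lY: "(l, i) \<in> Y" "young_column T (Y - {(l, i)})"
      using * by (auto simp: removable_def c)
    have lH: "(l, i) \<in> H" using young_column_subset[OF Y lY(1)] .
    \<comment> \<open>Without a lower \<open>i\<close>-block, the top one would lack a block that
      every column containing it must have.\<close>
    have "l = k"
      using is_top_mem_iff[OF Y k, of l] lY(1) young_column_below[OF lY(2), of k i l i] lH kY
      by force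
    moreover have "(k + 1, x) \<notin> Y" "(u - 1, y) \<notin> Y"
      using young_column_below[OF lY(2) _ lH, of "k + 1" x] adj_commute
        young_column_below[OF lY(2) _ lH, of "u - 1" y] x y u(1) adj_irrefl[OF i] \<open>l = k\<close> by auto
    ultimately show "c = (k, i) \<and> (k + 1, x) \<notin> Y \<and> (u - 1, y) \<notin> Y" using c by blast
  next
    assume *: "c = (k, i) \<and> (k + 1, x) \<notin> Y \<and> (u - 1, y) \<notin> Y"
    obtain K where K: "\<And>k i. (k, i) \<in> Y \<Longrightarrow> k \<le> K" using young_column_bound[OF Y] by blast
    have "young_column T (Y - {(k, i)})"
    proof (rule young_columnI)
      obtain l where "l < k" "(l, i) \<in> H" using block_below[OF i] by blast
      then show "Y - {(k, i)} \<noteq> {}" using young_column_below[OF Y kY, of l i] by auto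
      show "Y - {(k, i)} \<subseteq> H" using young_column_subset[OF Y] by blast
      show "l \<le> K" if "(l, j) \<in> Y - {(k, i)}" for l j
        using that K[of l j] by auto
      show "(l - 1, m) \<in> Y - {(k, i)}"
        if "(l, j) \<in> Y - {(k, i)}" "(l - 1, m) \<in> H" "adj T j m" for l j m
      proof -
        \<comment> \<open>A block resting on \<open>(k, i)\<close> would be one of the two upper
          neighbours, and both are absent from \<open>Y\<close>.\<close>
        have "(l - 1, m) \<noteq> (k, i)"
        proof
          assume eq: "(l - 1, m) = (k, i)"
          then have "(k + 1, j) \<in> Y" "adj T i j" using that adj_commute by auto
          then have "(k + 1, j) \<in> {(l, j) \<in> Y. adj T i j \<and> k < l}" by auto
          then show False using set * by auto
        qed
        then show ?thesis using that young_column_closed[OF Y, of l j m] by auto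
      qed
    qed
    then show "removable T i Y c" using * kY by (auto simp: removable_def)
  qed
  show ?thesis using that[of k u "(k + 1, x)" "(u - 1, y)"] k u xy add rem set by auto
qed

section \<open>Crystal operators and weights of columns\<close>

lemma addable_unique:
  assumes "young_column T Y" "i \<in> index_set T" "addable T i Y b" "addable T i Y c"
  shows "b = c"
  by (rule top_neighbours[OF assms(1,2)]) (use assms(3,4) in simp)

lemma removable_unique:
  assumes "young_column T Y" "i \<in> index_set T" "removable T i Y b" "removable T i Y c"
  shows "b = c"
  by (rule top_neighbours[OF assms(1,2)]) (use assms(3,4) in simp)

lemma not_addable_removable:
  assumes "young_column T Y" "i \<in> index_set T" "addable T i Y b"
  shows "\<not> removable T i Y c"
  by (rule top_neighbours[OF assms(1,2)]) (use assms(3) in simp)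

text \<open>Uniqueness of the addable block determines the value of the \<open>SOME\<close> in
  \<open>column_f\<close>.\<close>

lemma column_f_Some_iff:
  assumes "young_column T Y" "i \<in> index_set T"
  shows "column_f T i Y = Some Y' \<longleftrightarrow> (\<exists>b. addable T i Y b \<and> Y' = insert b Y)"
proof (cases "\<exists>b. addable T i Y b")
  case True
  then obtain b where b: "addable T i Y b" by blast
  then have "(SOME b. addable T i Y b) = b" using addable_unique[OF assms] by blast
  then have "column_f T i Y = Some (insert b Y)" using True by (simp add: column_f_def)
  then show ?thesis using b addable_unique[OF assms b] by (metis option.inject)
qed (simp add: column_f_def)

lemma column_e_Some_iff:
  assumes "young_column T Y" "i \<in> index_set T"
  shows "column_e T i Y = Some Y' \<longleftrightarrow> (\<exists>b. removable T i Y b \<and> Y' = Y - {b})"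
proof (cases "\<exists>b. removable T i Y b")
  case True
  then obtain b where b: "removable T i Y b" by blast
  then have "(SOME b. removable T i Y b) = b" using removable_unique[OF assms] by blast
  then have "column_e T i Y = Some (Y - {b})" using True by (simp add: column_e_def)
  then show ?thesis using b removable_unique[OF assms b] by (metis option.inject)
qed (simp add: column_e_def)

lemma addable_imp_removable:
  "young_column T Y \<Longrightarrow> addable T i Y b \<Longrightarrow> young_column T (insert b Y) \<and> removable T i (insert b Y) b"
  by (auto simp: addable_def removable_def)

lemma removable_imp_addable:
  "young_column T Y \<Longrightarrow> removable T i Y b \<Longrightarrow> young_column T (Y - {b}) \<and> addable T i (Y - {b}) b"
  using young_column_subset by (auto simp: addable_def removable_def insert_absorb)

text \<open>An \<open>i\<close>-block that has just been added is removable, so no further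
  \<open>i\<close>-block is addable and the string stops after one step.\<close>

lemma column_phi_eq:
  assumes "young_column T Y" "i \<in> index_set T"
  shows "column_phi T i Y = (if \<exists>b. addable T i Y b then 1 else 0)"
proof -
  have "column_f T i Y' = None" if Y': "column_f T i Y = Some Y'" for Y'
  proof -
    obtain b where b: "addable T i Y b" "Y' = insert b Y"
      using Y' column_f_Some_iff[OF assms] by blast
    then show ?thesis
      using addable_imp_removable[OF assms(1) b(1)] not_addable_removable[OF _ assms(2)]
      unfolding column_f_def b(2) by meson
  qed
  then show ?thesis
    unfolding column_phi_def by (subst string_length_le_1) (auto simp: column_f_def)
qed

lemma column_eps_eq:
  assumes "young_column T Y" "i \<in> index_set T"
  shows "column_eps T i Y = (if \<exists>b. removable T i Y b then 1 else 0)"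
proof -
  have "column_e T i Y' = None" if Y': "column_e T i Y = Some Y'" for Y'
  proof -
    obtain b where b: "removable T i Y b" "Y' = Y - {b}"
      using Y' column_e_Some_iff[OF assms] by blast
    then show ?thesis
      using removable_imp_addable[OF assms(1) b(1)] not_addable_removable[OF _ assms(2)]
      unfolding column_e_def b(2) by meson
  qed
  then show ?thesis
    unfolding column_eps_def by (subst string_length_le_1) (auto simp: column_e_def)
qed

lemma column_wt_cases:
  assumes "young_column T Y" "i \<in> index_set T"
  obtains (add) b where "addable T i Y b" "\<And>c. \<not> removable T i Y c" "column_wt T Y i = 1"
  | (rem) b where "removable T i Y b" "\<And>c. \<not> addable T i Y c" "column_wt T Y i = -1"
  | (none) "\<And>c. \<not> removable T i Y c" "\<And>c. \<not> addable T i Y c" "column_wt T Y i = 0"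
proof -
  have "column_wt T Y i = column_phi T i Y - column_eps T i Y"
    using assms by (simp add: column_wt_def)
  then show ?thesis
    using that not_addable_removable[OF assms] column_phi_eq[OF assms] column_eps_eq[OF assms]
    by (cases "\<exists>b. addable T i Y b"; cases "\<exists>b. removable T i Y b") auto
qed

lemma column_wt_eq_1_iff:
  "young_column T Y \<Longrightarrow> i \<in> index_set T \<Longrightarrow> column_wt T Y i = 1 \<longleftrightarrow> (\<exists>b. addable T i Y b)"
  by (cases rule: column_wt_cases; assumption?) auto

lemma column_wt_eq_minus_1_iff:
  "young_column T Y \<Longrightarrow> i \<in> index_set T \<Longrightarrow> column_wt T Y i = -1 \<longleftrightarrow> (\<exists>b. removable T i Y b)"
  by (cases rule: column_wt_cases; assumption?) auto

text \<open>Of the two possible upper neighbours, both present means addable (value 1), both absent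
  means removable (value -1), and exactly one present means neither (value 0).\<close>

lemma column_wt_top:
  assumes Y: "young_column T Y" and i: "i \<in> index_set T" and top: "is_top Y i k"
  shows "column_wt T Y i = int (card {(l, j) \<in> Y. adj T i j \<and> k < l}) - 1"
proof -
  obtain k' u a b where k': "is_top Y i k'" "a \<noteq> b"
    "\<And>c. addable T i Y c \<longleftrightarrow> c = (u, i) \<and> a \<in> Y \<and> b \<in> Y"
    "\<And>c. removable T i Y c \<longleftrightarrow> c = (k', i) \<and> a \<notin> Y \<and> b \<notin> Y"
    "{(l, j) \<in> Y. adj T i j \<and> k' < l} = {a, b} \<inter> Y"
    by (rule top_neighbours[OF Y i]) blast
  have [simp]: "k' = k" using is_top_unique k'(1) top by blast
  have set: "{(l, j) \<in> Y. adj T i j \<and> k < l} = {a, b} \<inter> Y" using k'(5) by simp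
  from Y i show ?thesis
    unfolding set
  proof (cases rule: column_wt_cases)
    case (add c)
    then have "{a, b} \<inter> Y = {a, b}" using k'(3) by blast
    then show "column_wt T Y i = int (card ({a, b} \<inter> Y)) - 1" using add k'(2) by simp
  next
    case (rem c)
    then have "{a, b} \<inter> Y = {}" using k'(4) by blast
    then show "column_wt T Y i = int (card ({a, b} \<inter> Y)) - 1" using rem by simp
  next
    case none
    then have "{a, b} \<inter> Y = {a} \<or> {a, b} \<inter> Y = {b}" using k'(3,4) by blast
    then show "column_wt T Y i = int (card ({a, b} \<inter> Y)) - 1" using none by auto
  qed
qed

text \<open>By \<open>column_wt_top\<close> the new block is one more upper neighbour for each
  adjacent colour and changes no count for the remaining ones, while colour \<open>i\<close> itself
  goes from 1 to -1. These are the entries of the negative of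
  \<open>simple_root T i\<close>.\<close>

lemma column_wt_insert:
  assumes Y: "young_column T Y" and i: "i \<in> index_set T" and b: "addable T i Y b"
  shows "column_wt T (insert b Y) = column_wt T Y - simple_root T i"
proof
  fix j
  note Y' = addable_imp_removable[OF Y b]
  obtain u where u: "b = (u, i)" "(u, i) \<in> H" "(u, i) \<notin> Y"
    using b by (cases b) (auto simp: addable_def)
  consider "j \<notin> index_set T" | "j = i" | "j \<noteq> i" "j \<in> index_set T" by blast
  then show "column_wt T (insert b Y) j = (column_wt T Y - simple_root T i) j"
  proof cases
    case 1
    then show ?thesis by (simp add: column_wt_def simple_root_def)
  next
    case 2
    have "column_wt T (insert b Y) i = -1"
      using Y' i column_wt_eq_minus_1_iff by blast
    moreover have "column_wt T Y i = 1"
      using Y i b column_wt_eq_1_iff by blast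
    ultimately show ?thesis using 2 i by (simp add: simple_root_def cartan_def)
  next
    case 3
    obtain k where k: "is_top Y j k" using top_exists[OF Y 3(2)] .
    then have "is_top (insert b Y) j k" using 3 u by (auto simp: is_top_def)
    then have wt': "column_wt T (insert b Y) j =
        int (card {(l, m) \<in> insert b Y. adj T j m \<and> k < l}) - 1"
      using column_wt_top Y' 3 by blast
    obtain k' u' x y where k': "is_top Y j k'"
        "{(l, m) \<in> Y. adj T j m \<and> k' < l} = {x, y} \<inter> Y"
      by (rule top_neighbours[OF Y 3(2)]) blast
    then have fin: "finite {(l, m) \<in> Y. adj T j m \<and> k < l}"
      using is_top_unique[OF k k'(1)] by simp
    show ?thesis
    proof (cases "adj T j i")
      case True
      \<comment> \<open>If the new block were below the top \<open>j\<close>-block it would already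
        belong to \<open>Y\<close>, and \<open>level\<close> rules out the same cube.\<close>
      have "k < u"
      proof (rule ccontr)
        assume "\<not> k < u"
        moreover have "k \<noteq> u"
          using level[OF True] k u(2) young_column_subset[OF Y] unfolding is_top_def by blast
        ultimately show False
          using young_column_below[OF Y _ u(2), of k j] k True u(3) by (auto simp: is_top_def)
      qed
      then have "{(l, m) \<in> insert b Y. adj T j m \<and> k < l} =
          insert b {(l, m) \<in> Y. adj T j m \<and> k < l}"
        using u True by auto
      then show ?thesis
        using wt' column_wt_top[OF Y 3(2) k] fin u True 3
        by (simp add: simple_root_def cartan_def)
    next
      case False
      then have "{(l, m) \<in> insert b Y. adj T j m \<and> k < l} = {(l, m) \<in> Y. adj T j m \<and> k < l}"
        using u by auto
      then show ?thesis
        using wt' column_wt_top[OF Y 3(2) k] False 3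
        by (simp add: simple_root_def cartan_def)
    qed
  qed
qed

lemma column_wt_remove:
  assumes "young_column T Y" "i \<in> index_set T" "removable T i Y b"
  shows "column_wt T (Y - {b}) = column_wt T Y + simple_root T i"
proof -
  have "insert b (Y - {b}) = Y" using assms(3) by (auto simp: removable_def)
  then show ?thesis
    using column_wt_insert[of "Y - {b}" i b] removable_imp_addable[OF assms(1,3)] assms(2)
    by (simp add: fun_eq_iff)
qed

section \<open>Equivalence as translation by periods\<close>

lemma young_column_shift_imp: "young_column T Y \<Longrightarrow> young_column T (shift (n * P) Y)"
proof -
  assume Y: "young_column T Y"
  obtain K where K: "\<And>k i. (k, i) \<in> Y \<Longrightarrow> k \<le> K" using young_column_bound[OF Y] by blast
  have per: "(k - n * P, i) \<in> H \<longleftrightarrow> (k, i) \<in> H" for k i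
    using period[of "k - n * P" n i] by simp
  show ?thesis
  proof (rule young_columnI)
    show "shift (n * P) Y \<noteq> {}" using Y by (auto simp: shift_def young_column_iff)
    have "(k, i) \<in> H" if "(k, i) \<in> shift (n * P) Y" for k i
      using that young_column_subset[OF Y, of "(k - n * P, i)"] per by simp
    then show "shift (n * P) Y \<subseteq> H" by auto
    show "k \<le> K + n * P" if "(k, i) \<in> shift (n * P) Y" for k i
      using that K[of "k - n * P" i] by simp
    show "(k - 1, j) \<in> shift (n * P) Y"
      if "(k, i) \<in> shift (n * P) Y" "(k - 1, j) \<in> H" "adj T i j" for k i j
      using that young_column_closed[OF Y, of "k - n * P" i j] per[of "k - 1" j]
      by (simp add: algebra_simps)
  qed
qed

lemma young_column_shift [simp]: "young_column T (shift (n * P) Y) \<longleftrightarrow> young_column T Y"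
  using young_column_shift_imp[of Y n] young_column_shift_imp[of "shift (n * P) Y" "-n"] by auto

lemma addable_shift [simp]:
  "addable T i (shift (n * P) Y) (k + n * P, j) \<longleftrightarrow> addable T i Y (k, j)"
  unfolding addable_def shift_insert[symmetric] by (simp add: period)

lemma removable_shift [simp]:
  "removable T i (shift (n * P) Y) (k + n * P, j) \<longleftrightarrow> removable T i Y (k, j)"
  unfolding removable_def shift_Diff[symmetric] by simp

lemma ex_addable_shift: "(\<exists>b. addable T i (shift (n * P) Y) b) \<longleftrightarrow> (\<exists>b. addable T i Y b)"
  using addable_shift by (metis surj_pair diff_add_cancel)

lemma ex_removable_shift: "(\<exists>b. removable T i (shift (n * P) Y) b) \<longleftrightarrow> (\<exists>b. removable T i Y b)"
  using removable_shift by (metis surj_pair diff_add_cancel)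

lemma column_wt_shift: 
  assumes "young_column T Y"
  shows "column_wt T (shift (n * P) Y) = column_wt T Y"
  using assms column_phi_eq column_eps_eq ex_addable_shift ex_removable_shift
  by (simp add: column_wt_def fun_eq_iff)

lemma solid_shift: "\<exists>r. move T (n * P) r ` solid T Y = solid T (shift (n * P) Y)"
proof -
  obtain r where r: "\<And>k i. footprint T (k + n * P, i) =
      (if r then rotate_cell T else id) ` footprint T (k, i)"
    using symmetry by blast
  have "move T (n * P) r ` solid T Y = solid T (shift (n * P) Y)"
  proof (intro set_eqI iffI)
    fix z assume "z \<in> move T (n * P) r ` solid T Y"
    then obtain k p i where kpi: "(k, i) \<in> Y" "p \<in> footprint T (k, i)"
        "z = ((k + n * P, if r then rotate_cell T p else p), i)"
      by (auto simp: solid_def move_def simp del: footprint.simps)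
    then have "(if r then rotate_cell T p else p) \<in> footprint T (k + n * P, i)"
      unfolding r by auto
    then show "z \<in> solid T (shift (n * P) Y)"
      using kpi by (simp add: mem_solid del: footprint.simps)
  next
    fix z assume "z \<in> solid T (shift (n * P) Y)"
    then obtain k q i where kqi: "(k - n * P, i) \<in> Y" "q \<in> footprint T (k, i)" "z = ((k, q), i)"
      by (auto simp: solid_def simp del: footprint.simps)
    then obtain p where p: "p \<in> footprint T (k - n * P, i)" "q = (if r then rotate_cell T p else p)"
      using r[of "k - n * P" i] by (auto simp del: footprint.simps)
    then have "((k - n * P, p), i) \<in> solid T Y"
      using kqi by (simp add: mem_solid del: footprint.simps)
    moreover have "z = move T (n * P) r ((k - n * P, p), i)"
      using p kqi by (simp add: move_def)
    ultimately show "z \<in> move T (n * P) r ` solid T Y" by blast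
  qed
  then show ?thesis by blast
qed

text \<open>Rotation moves only cells, so it disappears when a solid is projected to cubes and
  colours, and a vertical translation remains. The positions of the 0-blocks make its length a
  multiple of \<open>P\<close>. Conversely, \<open>solid_shift\<close> supplies the rotation that
  has to accompany such a translation.\<close>

lemma young_equiv_iff:
  "(Y, Y') \<in> young_equiv T \<longleftrightarrow> young_column T Y \<and> (\<exists>n. Y' = shift (n * P) Y)"
proof (intro iffI conjI)
  assume "(Y, Y') \<in> young_equiv T"
  then obtain t r where Y: "young_column T Y" and Y': "young_column T Y'"
    and move: "move T t r ` solid T Y = solid T Y'"
    by (auto simp: young_equiv_def)
  show "young_column T Y" by fact
  have proj: "Z = (\<lambda>((k, p), i). (k, i)) ` solid T Z" if "young_column T Z" for Z
  proof -
    have "\<exists>p. p \<in> footprint T (k, i)" if "(k, i) \<in> Z" for k i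
      using young_column_subset[OF \<open>young_column T Z\<close> that] unfolding blocks_def by blast
    then show ?thesis
      by (force simp: solid_def image_iff simp del: footprint.simps)
  qed
  have "Y' = (\<lambda>((k, p), i). (k, i)) ` move T t r ` solid T Y"
    using proj[OF Y'] move by simp
  also have "\<dots> = shift t ((\<lambda>((k, p), i). (k, i)) ` solid T Y)"
    unfolding shift_def image_image by (rule image_cong) (auto simp: move_def)
  finally have eq: "Y' = shift t Y" using proj[OF Y] by simp
  obtain k where k: "(k, 0) \<in> Y" using young_column_all_colours[OF Y zero_index] .
  have "(k + t, 0) \<in> Y'" using k by (simp add: eq)
  \<comment> \<open>Both 0-blocks lie in cubes congruent to 1 modulo \<open>P\<close>.\<close>
  then have "P dvd (k + t - 1) - (k - 1)"
    using k zero_block young_column_subset Y Y' by (metis dvd_diff)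
  then obtain n where "t = n * P" by (auto simp: dvd_def mult.commute)
  then show "\<exists>n. Y' = shift (n * P) Y" using eq by blast
next
  assume "young_column T Y \<and> (\<exists>n. Y' = shift (n * P) Y)"
  then obtain n where "young_column T Y" "Y' = shift (n * P) Y" by blast
  then show "(Y, Y') \<in> young_equiv T"
    using solid_shift[of n Y] unfolding young_equiv_def by auto
qed

lemma young_class_eq:
  "young_column T Y \<Longrightarrow> young_class T Y = range (\<lambda>n. shift (n * P) Y)"
  by (auto simp: young_class_def young_equiv_iff)

lemma young_class_shift:
  assumes "young_column T Y"
  shows "young_class T (shift (n * P) Y) = young_class T Y"
proof -
  have "\<exists>m'. shift (m * P) (shift (n * P) Y) = shift (m' * P) Y" for m
    by (rule exI[of _ "n + m"]) (simp add: algebra_simps)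
  moreover have "\<exists>m'. shift (m * P) Y = shift (m' * P) (shift (n * P) Y)" for m
    by (rule exI[of _ "m - n"]) (simp add: algebra_simps)
  ultimately have "range (\<lambda>m. shift (m * P) (shift (n * P) Y)) = range (\<lambda>m. shift (m * P) Y)"
    by (auto simp: image_iff simp del: shift_shift)
  then show ?thesis using assms by (simp add: young_class_eq)
qed

lemma top_normalise:
  assumes Y: "young_column T Y"
  obtains n where "is_top (shift (n * P) Y) 0 1"
proof -
  obtain k where k: "is_top Y 0 k" using top_exists[OF Y zero_index] .
  then have "(k, 0) \<in> H" using young_column_subset[OF Y] by (auto simp: is_top_def)
  then obtain m where m: "k - 1 = P * m" using zero_block by (auto simp: dvd_def)
  have "is_top (shift (- m * P) Y) 0 1"
    using k m by (auto simp: is_top_def algebra_simps)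
  then show ?thesis using that by blast
qed

section \<open>Reduction to the least column\<close>

definition least_column :: "block set \<Rightarrow> bool" where
  "least_column J \<longleftrightarrow> young_column T J \<and> (1, 0) \<in> J \<and>
    (\<forall>Y. young_column T Y \<longrightarrow> (1, 0) \<in> Y \<longrightarrow> J \<subseteq> Y)"

lemma least_column_not_removable:
  assumes "least_column J" "i \<noteq> 0"
  shows "\<not> removable T i J b"
proof
  assume *: "removable T i J b"
  then have "(1, 0) \<in> J - {b}" using assms by (auto simp: least_column_def removable_def)
  then have "J \<subseteq> J - {b}" using * assms unfolding least_column_def removable_def by blast
  then show False using * by (auto simp: removable_def)
qed

text \<open>A block of \<open>Y\<close> outside \<open>J\<close> in the highest possible cube is
  removable: a block resting on it would lie outside \<open>J\<close> as well, since
  \<open>J\<close> is closed downwards, and would be higher. Its colour is not 0 because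
  \<open>J\<close> contains every 0-block up to cube 1.\<close>

lemma removable_outside_least:
  assumes J: "least_column J" and Y: "young_column T Y" and top: "is_top Y 0 1" and ne: "Y \<noteq> J"
  obtains i b where "i \<in> index_set T" "i \<noteq> 0" "removable T i Y b" "b \<notin> J"
proof -
  have JY: "J \<subseteq> Y" and Jy: "young_column T J" "(1, 0) \<in> J"
    using J Y top by (auto simp: least_column_def is_top_def)
  obtain k0 i0 where k0: "(k0, i0) \<in> Y - J" using JY ne by auto
  obtain K where K: "\<And>k i. (k, i) \<in> Y \<Longrightarrow> k \<le> K" using young_column_bound[OF Y] by blast
  obtain k where "k \<in> {k. \<exists>i. (k, i) \<in> Y - J}"
    and max: "\<And>l. l \<in> {k. \<exists>i. (k, i) \<in> Y - J} \<Longrightarrow> l \<le> k"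
    using int_set_has_greatest[of k0 "{k. \<exists>i. (k, i) \<in> Y - J}" K] k0 K by blast
  then obtain i where i: "(k, i) \<in> Y" "(k, i) \<notin> J" by blast
  have kH: "(k, i) \<in> H" using young_column_subset[OF Y i(1)] .
  have "young_column T (Y - {(k, i)})"
  proof (rule young_columnI)
    show "Y - {(k, i)} \<noteq> {}" using JY Jy(2) i by blast
    show "Y - {(k, i)} \<subseteq> H" using young_column_subset[OF Y] by blast
    show "l \<le> K" if "(l, j) \<in> Y - {(k, i)}" for l j
      using that K by blast
    show "(l - 1, m) \<in> Y - {(k, i)}"
      if l: "(l, j) \<in> Y - {(k, i)}" "(l - 1, m) \<in> H" "adj T j m" for l j m
    proof -
      have "(l - 1, m) \<noteq> (k, i)"
      proof
        assume eq: "(l - 1, m) = (k, i)"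
        then have "(l, j) \<notin> J" using young_column_closed[OF Jy(1), of l j m] l i by auto
        then have "l \<le> k" using max[of l] l by blast
        then show False using eq by simp
      qed
      then show ?thesis using young_column_closed[OF Y, of l j m] l by blast
    qed
  qed
  then have "removable T i Y (k, i)" using i by (simp add: removable_def)
  moreover have "i \<noteq> 0"
    using is_top_mem_iff[OF Y top, of k] is_top_def young_column_below[OF Jy, of k 0] i kH
    by (metis order_le_less Jy(2))
  ultimately show ?thesis using that i block_colour[OF kH] by blast
qed

text \<open>In each colour these blocks lie above the top block of \<open>J\<close> and within the
  height bound of \<open>Y\<close>. This makes \<open>card (Y - J)\<close> usable as an induction
  measure.\<close>

lemma finite_outside_least:
  assumes J: "least_column J" and Y: "young_column T Y"
  shows "finite (Y - J)"
proof -
  have Jy: "young_column T J" using J by (auto simp: least_column_def)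
  obtain K where K: "\<And>k i. (k, i) \<in> Y \<Longrightarrow> k \<le> K" using young_column_bound[OF Y] by blast
  have "\<forall>i\<in>index_set T. \<exists>k. is_top J i k" using top_exists[OF Jy] by blast
  then obtain t where t: "\<And>i. i \<in> index_set T \<Longrightarrow> is_top J i (t i)" by metis
  have "Y - J \<subseteq> (\<Union>i\<in>index_set T. {t i..K} \<times> {i})"
  proof
    fix b assume b: "b \<in> Y - J"
    obtain k i where ki: "b = (k, i)" by (cases b)
    have "(k, i) \<in> H" "i \<in> index_set T"
      using b ki young_column_subset[OF Y] block_colour by blast+
    then have "t i \<le> k" using is_top_mem_iff[OF Jy t, of i k] b ki by force
    then show "b \<in> (\<Union>i\<in>index_set T. {t i..K} \<times> {i})"
      using b ki K \<open>i \<in> index_set T\<close> by auto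
  qed
  then show ?thesis by (rule finite_subset) (use finite_index in auto)
qed

text \<open>Blocks are stripped off until \<open>J\<close> remains; as colour 0 is never touched,
  the top 0-block stays in cube 1.\<close>

lemma least_column_induct [consumes 3, case_names base step]:
  assumes J: "least_column J" and "young_column T Y" "is_top Y 0 1"
    and base: "Q J"
    and step: "\<And>Y i b. young_column T Y \<Longrightarrow> is_top Y 0 1 \<Longrightarrow> i \<in> index_set T \<Longrightarrow> i \<noteq> 0 \<Longrightarrow>
      removable T i Y b \<Longrightarrow> young_column T (Y - {b}) \<Longrightarrow> is_top (Y - {b}) 0 1 \<Longrightarrow>
      Q (Y - {b}) \<Longrightarrow> Q Y"
  shows "Q Y"
  using assms(2,3)
proof (induction "card (Y - J)" arbitrary: Y rule: less_induct)
  case less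
  show ?case
  proof (cases "Y = J")
    case False
    obtain i b where ib: "i \<in> index_set T" "i \<noteq> 0" "removable T i Y b" "b \<notin> J"
      using removable_outside_least[OF J less.prems False] .
    then have "b \<in> Y" "snd b = i" "young_column T (Y - {b})" by (auto simp: removable_def)
    moreover have "is_top (Y - {b}) 0 1" using less.prems(2) ib(2) \<open>snd b = i\<close> by (auto simp: is_top_def)
    moreover have "Y - {b} - J \<subset> Y - J" using \<open>b \<in> Y\<close> ib(4) by blast
    then have "card (Y - {b} - J) < card (Y - J)"
      using psubset_card_mono finite_outside_least[OF J less.prems(1)] by blast
    ultimately show ?thesis using less.hyps step[OF less.prems ib(1-3)] by blast
  qed (use base in simp)
qed

text \<open>Removability is read off the weight, so two normalised columns of equal weight can be
  dismantled in parallel until \<open>J\<close> is reached, where no block of nonzero colour is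
  removable.\<close>

lemma column_wt_inj_normalised:
  assumes J: "least_column J" and "young_column T Y" "is_top Y 0 1"
    and "young_column T Y'" "is_top Y' 0 1" "column_wt T Y' = column_wt T Y"
  shows "Y' = Y"
  using assms
proof (induction arbitrary: Y' rule: least_column_induct)
  case base
  show ?case
  proof (rule ccontr)
    assume "Y' \<noteq> J"
    then obtain i b where ib: "i \<in> index_set T" "i \<noteq> 0" "removable T i Y' b"
      using removable_outside_least[OF J base(1,2)] by blast
    have Jy: "young_column T J" using J by (simp add: least_column_def)
    have "column_wt T J i = -1"
      using base(3) column_wt_eq_minus_1_iff[OF base(1) ib(1)] ib(3) by metis
    then obtain c where "removable T i J c"
      using column_wt_eq_minus_1_iff[OF Jy ib(1)] by auto
    then show False using least_column_not_removable J ib by blast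
  qed
next
  case (step Y i b)
  note Y = step(1-3) and Y' = step(9-11) and b = step(5)
  have "column_wt T Y' i = -1"
    using column_wt_eq_minus_1_iff[OF Y(1,3)] Y'(3) b by metis
  then obtain c where c: "removable T i Y' c"
    using column_wt_eq_minus_1_iff[OF Y'(1) Y(3)] by auto
  have Y'c: "young_column T (Y' - {c})" "is_top (Y' - {c}) 0 1"
    using c step(4) Y'(2) by (auto simp: removable_def is_top_def)
  have "column_wt T (Y' - {c}) = column_wt T (Y - {b})"
    using column_wt_remove[OF Y'(1) Y(3) c] column_wt_remove[OF Y(1,3) b] Y'(3) by simp
  then have eq: "Y' - {c} = Y - {b}" using step(8)[OF Y'c] by simp
  \<comment> \<open>Both are the unique addable \<open>i\<close>-block of the common smaller
    column.\<close>
  moreover have "c = b"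
    using addable_unique[OF step(6) Y(3)] removable_imp_addable[OF Y(1) b]
      removable_imp_addable[OF Y'(1) c] eq by simp
  ultimately show ?case using c b by (auto simp: removable_def)
qed

section \<open>Classes, weights and the finite Weyl orbit\<close>

lemma young_class_eq_iff_column_wt:
  assumes J: "least_column J" and Y: "young_column T Y" and Y': "young_column T Y'"
  shows "young_class T Y = young_class T Y' \<longleftrightarrow> column_wt T Y = column_wt T Y'"
proof
  assume "young_class T Y = young_class T Y'"
  then have "shift (0 * P) Y \<in> young_class T Y'" 
    using young_class_eq[OF Y] by blast
  then show "column_wt T Y = column_wt T Y'"
    using Y' by (auto simp: young_class_eq column_wt_shift)
next
  assume *: "column_wt T Y = column_wt T Y'"
  \<comment> \<open>Translation by periods changes neither weight nor class, so both columns may be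
    normalised first.\<close>
  obtain m n where "is_top (shift (m * P) Y) 0 1" "is_top (shift (n * P) Y') 0 1"
    using top_normalise Y Y' by metis
  then have "shift (m * P) Y = shift (n * P) Y'"
    using column_wt_inj_normalised[OF J] Y Y' * column_wt_shift by simp
  then show "young_class T Y = young_class T Y'" using young_class_shift Y Y' by metis
qed

text \<open>The pairing takes only the values 1, -1 and 0, for which the reflection amounts to
  adding a block, removing one, or doing nothing.\<close>

lemma simple_reflection_column_wt:
  assumes Y: "young_column T Y" and i: "i \<in> index_set T"
  obtains Y' where "young_column T Y'" "simple_reflection T i (column_wt T Y) = column_wt T Y'"
  using Y i
proof (cases rule: column_wt_cases)
  case (add b)
  then show ?thesis
    using that[of "insert b Y"] addable_imp_removable[OF Y add(1)] column_wt_insert[OF Y i add(1)]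
    by (simp add: simple_reflection_def pairing_def fun_eq_iff)
next
  case (rem b)
  then show ?thesis
    using that[of "Y - {b}"] removable_imp_addable[OF Y rem(1)] column_wt_remove[OF Y i rem(1)]
    by (simp add: simple_reflection_def pairing_def fun_eq_iff)
next
  case none
  then show ?thesis
    using that[of Y] Y by (simp add: simple_reflection_def pairing_def fun_eq_iff)
qed

text \<open>Reflections preserve the set of column weights, which gives one inclusion. For the
  other, after normalisation \<open>least_column_induct\<close> handles only blocks of nonzero
  colour, hence only reflections in the finite Weyl group.\<close>

lemma weyl_orbit_column_wt:
  assumes J: "least_column J"
  shows "weyl_orbit T (column_wt T J) = column_wt T ` {Y. young_column T Y}"
proof (intro equalityI subsetI)
  fix \<mu> assume "\<mu> \<in> weyl_orbit T (column_wt T J)"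
  then obtain w where "w \<in> finite_weyl_group T" "\<mu> = w (column_wt T J)"
    by (auto simp: weyl_orbit_def)
  moreover from this(1) have "\<exists>Y. young_column T Y \<and> w (column_wt T J) = column_wt T Y"
  proof induction
    case one
    then show ?case using J by (auto simp: least_column_def)
  next
    case (mult i w)
    then show ?case using simple_reflection_column_wt by (metis DiffD1 comp_apply)
  qed
  ultimately show "\<mu> \<in> column_wt T ` {Y. young_column T Y}" by auto
next
  fix \<mu> assume "\<mu> \<in> column_wt T ` {Y. young_column T Y}"
  then obtain Y n where Y: "young_column T Y" "is_top (shift (n * P) Y) 0 1"
    and \<mu>: "\<mu> = column_wt T (shift (n * P) Y)"
    using top_normalise column_wt_shift by (metis (no_types, lifting) imageE mem_Collect_eq)
  from Y(1) have Y1: "young_column T (shift (n * P) Y)" by simp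
  from J Y1 Y(2) show "\<mu> \<in> weyl_orbit T (column_wt T J)"
    unfolding \<mu>
  proof (induction rule: least_column_induct)
    case base
    have "id (column_wt T J) \<in> weyl_orbit T (column_wt T J)"
      unfolding weyl_orbit_def by (rule imageI) (rule finite_weyl_group.one)
    then show ?case by simp
  next
    case (step Y i b)
    then obtain w where w: "w \<in> finite_weyl_group T"
      "column_wt T (Y - {b}) = w (column_wt T J)" by (auto simp: weyl_orbit_def)
    have "column_wt T Y i = -1" using column_wt_eq_minus_1_iff[OF step(1,3)] step(5) by metis
    moreover have "simple_root T i i = 2" using step by (simp add: simple_root_def cartan_def)
    ultimately have "column_wt T Y = simple_reflection T i (column_wt T (Y - {b}))"
      using column_wt_remove[OF step(1,3,5)]
      by (simp add: simple_reflection_def pairing_def fun_eq_iff)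
    then have "column_wt T Y = (simple_reflection T i \<circ> w) (column_wt T J)" using w by simp
    moreover have "simple_reflection T i \<circ> w \<in> finite_weyl_group T"
      using step w by (intro finite_weyl_group.mult) auto
    ultimately show ?case unfolding weyl_orbit_def by blast
  qed
qed

section \<open>The orbit crystal\<close>

lemma simple_root_self: "i \<in> index_set T \<Longrightarrow> simple_root T i i = 2"
  by (simp add: simple_root_def cartan_def)

text \<open>One application moves the pairing from -1 to 1, so a second one is impossible.\<close>

lemma string_length_orbit_e:
  "i \<in> index_set T \<Longrightarrow> string_length (orbit_e T i) \<mu> = (if \<mu> i = -1 then 1 else 0)"
  by (subst string_length_le_1)
     (auto simp: orbit_e_def pairing_def simple_root_self split: if_splits)

lemma string_length_orbit_f:
  "i \<in> index_set T \<Longrightarrow> string_length (orbit_f T i) \<mu> = (if \<mu> i = 1 then 1 else 0)"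
  by (subst string_length_le_1)
     (auto simp: orbit_f_def pairing_def simple_root_self split: if_splits)

lemma column_f_orbit:
  assumes Y: "young_column T Y" and i: "i \<in> index_set T"
  shows "map_option (column_wt T) (column_f T i Y) = orbit_f T i (column_wt T Y)"
  using Y i
proof (cases rule: column_wt_cases)
  case (add b)
  then have "column_f T i Y = Some (insert b Y)" using column_f_Some_iff[OF Y i] by blast
  then show ?thesis using add column_wt_insert[OF Y i] by (simp add: orbit_f_def pairing_def)
qed (auto simp: column_f_def orbit_f_def pairing_def)

lemma column_e_orbit:
  assumes Y: "young_column T Y" and i: "i \<in> index_set T"
  shows "map_option (column_wt T) (column_e T i Y) = orbit_e T i (column_wt T Y)"
  using Y i
proof (cases rule: column_wt_cases)
  case (rem b)
  then have "column_e T i Y = Some (Y - {b})" using column_e_Some_iff[OF Y i] by blast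
  then show ?thesis using rem column_wt_remove[OF Y i] by (simp add: orbit_e_def pairing_def)
qed (auto simp: column_e_def orbit_e_def pairing_def)

lemma column_f_young:
  assumes "young_column T Y" "i \<in> index_set T" "column_f T i Y = Some Y'"
  shows "young_column T Y'"
proof -
  obtain b where "addable T i Y b" "Y' = insert b Y"
    using assms(3) column_f_Some_iff[OF assms(1,2)] by blast
  then show ?thesis using addable_imp_removable[OF assms(1)] by blast
qed

lemma column_e_young:
  assumes "young_column T Y" "i \<in> index_set T" "column_e T i Y = Some Y'"
  shows "young_column T Y'"
proof -
  obtain b where "removable T i Y b" "Y' = Y - {b}"
    using assms(3) column_e_Some_iff[OF assms(1,2)] by blast
  then show ?thesis using removable_imp_addable[OF assms(1)] by blast
qed

text \<open>Orbit elements are weights of columns. This confines the pairings to -1, 0 and 1, and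
  gives stability under the operators, those of the affine node included, since adding or removing a
  block yields a column again.\<close>

lemma classical_crystal_orbit:
  assumes J: "least_column J"
  shows "classical_crystal T (orbit_crystal T (column_wt T J))" (is "classical_crystal T ?B")
proof -
  have elts: "elts ?B = column_wt T ` {Y. young_column T Y}"
    by (simp add: orbit_crystal_def weyl_orbit_column_wt[OF J])
  have lat: "column_wt T Y \<in> weight_lattice T" for Y
    by (simp add: column_wt_def weight_lattice_def)
  have vals: "column_wt T Y i \<in> {-1, 0, 1}" if "young_column T Y" "i \<in> index_set T" for Y i
    using that by (cases rule: column_wt_cases) auto
  have e: "column_wt T Y + simple_root T i \<in> column_wt T ` {Y. young_column T Y}"
    if "young_column T Y" "i \<in> index_set T" "column_wt T Y i = -1" for Y i
    using column_e_orbit[OF that(1,2)] column_e_young[OF that(1,2)] that(3)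
    by (force simp: orbit_e_def pairing_def image_iff)
  have f: "column_wt T Y - simple_root T i \<in> column_wt T ` {Y. young_column T Y}"
    if "young_column T Y" "i \<in> index_set T" "column_wt T Y i = 1" for Y i
    using column_f_orbit[OF that(1,2)] column_f_young[OF that(1,2)] that(3)
    by (force simp: orbit_f_def pairing_def image_iff)
  have inv: "orbit_f T i \<mu> = Some \<nu> \<longleftrightarrow> orbit_e T i \<nu> = Some \<mu>" if "i \<in> index_set T" for i \<mu> \<nu>
  proof -
    have "\<mu> - simple_root T i = \<nu> \<longleftrightarrow> \<nu> + simple_root T i = \<mu>" by (metis diff_add_cancel add_diff_cancel)
    moreover have "\<mu> i = 1 \<longleftrightarrow> \<nu> i = -1" if "\<nu> + simple_root T i = \<mu>"
      using simple_root_self[OF \<open>i \<in> index_set T\<close>] that by auto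
    ultimately show ?thesis by (auto simp: orbit_e_def orbit_f_def pairing_def)
  qed
  have string: "(if \<mu> i = 1 then 1 else 0) = (if \<mu> i = -1 then 1 else 0) + \<mu> i"
    if "i \<in> index_set T" "\<mu> \<in> column_wt T ` {Y. young_column T Y}" for i \<mu>
    using vals that by fastforce
  note defs = orbit_crystal_def string_length_orbit_e string_length_orbit_f pairing_def
    orbit_e_def orbit_f_def simple_root_self
  show ?thesis
    unfolding classical_crystal_def
  proof (intro conjI ballI)
    show "wt ?B \<mu> \<in> weight_lattice T" if "\<mu> \<in> elts ?B" for \<mu>
      using that lat unfolding elts by (auto simp: orbit_crystal_def)
  next
    fix i \<mu> assume i: "i \<in> index_set T" and "\<mu> \<in> elts ?B"
    then have \<mu>: "\<mu> \<in> column_wt T ` {Y. young_column T Y}" by (simp add: elts)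
    show "eps ?B i \<mu> \<noteq> Pinf" "phi ?B i \<mu> \<noteq> Pinf" by (auto simp: orbit_crystal_def)
    show "phi ?B i \<mu> = eps ?B i \<mu> + Fin (pairing i (wt ?B \<mu>))"
      using string[OF i \<mu>] i by (auto simp: defs split: if_splits)
    show "\<forall>\<nu>. eop ?B i \<mu> = Some \<nu> \<longrightarrow> \<nu> \<in> elts ?B \<and> wt ?B \<nu> = wt ?B \<mu> + simple_root T i \<and>
        eps ?B i \<nu> = eps ?B i \<mu> + Fin (-1) \<and> phi ?B i \<nu> = phi ?B i \<mu> + Fin 1"
      using e i \<mu> unfolding elts by (auto simp: defs)
    show "\<forall>\<nu>. fop ?B i \<mu> = Some \<nu> \<longrightarrow> \<nu> \<in> elts ?B \<and> wt ?B \<nu> = wt ?B \<mu> - simple_root T i \<and>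
        eps ?B i \<nu> = eps ?B i \<mu> + Fin 1 \<and> phi ?B i \<nu> = phi ?B i \<mu> + Fin (-1)"
      using f i \<mu> unfolding elts by (auto simp: defs)
    show "fop ?B i \<mu> = Some \<nu> \<longleftrightarrow> eop ?B i \<nu> = Some \<mu>" for \<nu>
      using inv[OF i] by (simp add: orbit_crystal_def)
    show "phi ?B i \<mu> = Minf \<longrightarrow> eop ?B i \<mu> = None \<and> fop ?B i \<mu> = None"
      by (simp add: orbit_crystal_def)
  qed
qed

section \<open>Descent to classes and the isomorphism\<close>

lemma the_elem_young_class:
  assumes Y: "young_column T Y" and g: "\<And>n. g (shift (n * P) Y) = g Y"
  shows "the_elem (g ` young_class T Y) = g Y"
proof -
  have "g ` young_class T Y = {g Y}"
    using g rangeI[of "\<lambda>n. shift (n * P) Y" 0] by (auto simp: young_class_eq[OF Y])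
  then show ?thesis by simp
qed

lemma crystal_isomorphism_young:
  assumes J: "least_column J"
  shows "\<exists>\<psi>. crystal_isomorphism T (orbit_crystal T (column_wt T J)) (young_crystal T) \<psi>"
proof -
  \<comment> \<open>The choice of column is immaterial, as its weight determines its class.\<close>
  define \<psi> where "\<psi> \<mu> = young_class T (SOME Y. young_column T Y \<and> column_wt T Y = \<mu>)" for \<mu>
  have \<psi>: "\<psi> (column_wt T Y) = young_class T Y" if "young_column T Y" for Y
  proof -
    have "young_column T (SOME Z. young_column T Z \<and> column_wt T Z = column_wt T Y) \<and>
        column_wt T (SOME Z. young_column T Z \<and> column_wt T Z = column_wt T Y) = column_wt T Y"
      using that by (intro someI[of "\<lambda>Z. young_column T Z \<and> column_wt T Z = column_wt T Y"]) simp
    then show ?thesis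
      unfolding \<psi>_def using young_class_eq_iff_column_wt[OF J] that by blast
  qed
  let ?B = "orbit_crystal T (column_wt T J)"
  have elts: "elts ?B = column_wt T ` {Y. young_column T Y}"
    by (simp add: orbit_crystal_def weyl_orbit_column_wt[OF J])
  have f: "map_option \<psi> (orbit_f T i (column_wt T Y)) = map_option (young_class T) (column_f T i Y)"
    if "young_column T Y" "i \<in> index_set T" for Y i
    using column_f_young[OF that] \<psi> unfolding column_f_orbit[OF that, symmetric]
    by (cases "column_f T i Y") auto
  have e: "map_option \<psi> (orbit_e T i (column_wt T Y)) = map_option (young_class T) (column_e T i Y)"
    if "young_column T Y" "i \<in> index_set T" for Y i
    using column_e_young[OF that] \<psi> unfolding column_e_orbit[OF that, symmetric]
    by (cases "column_e T i Y") auto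
  have "crystal_isomorphism T ?B (young_crystal T) \<psi>"
  proof (rule classical_crystal_transfer)
    show "classical_crystal T ?B" using classical_crystal_orbit[OF J] .
    have "inj_on \<psi> (elts ?B)"
      using young_class_eq_iff_column_wt[OF J] by (auto simp: elts inj_on_def \<psi>)
    moreover have "\<psi> ` elts ?B = elts (young_crystal T)"
      by (auto simp: elts young_crystal_def \<psi> quotient_def young_class_def image_iff)
    ultimately show "bij_betw \<psi> (elts ?B) (elts (young_crystal T))"
      by (simp add: bij_betw_def)
  next
    fix \<mu> assume "\<mu> \<in> elts ?B"
    then obtain Y where Y: "young_column T Y" and \<mu>: "\<mu> = column_wt T Y" by (auto simp: elts)
    show "wt (young_crystal T) (\<psi> \<mu>) = wt ?B \<mu>"
      using the_elem_young_class[OF Y column_wt_shift[OF Y]]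
      by (simp add: \<mu> \<psi>[OF Y] young_crystal_def orbit_crystal_def)
    fix i assume i: "i \<in> index_set T"
    have wt: "(column_wt T Y i = 1) = (\<exists>b. addable T i Y b)"
      "(column_wt T Y i = -1) = (\<exists>b. removable T i Y b)"
      using Y i by (cases rule: column_wt_cases; auto)+
    have Ys: "young_column T (shift (n * P) Y)" for n using Y by simp
    show "eps (young_crystal T) i (\<psi> \<mu>) = eps ?B i \<mu>"
      using the_elem_young_class[OF Y, of "column_eps T i"] column_eps_eq[OF Ys i] column_eps_eq[OF Y i]
        ex_removable_shift wt
      by (simp add: \<mu> \<psi>[OF Y] young_crystal_def orbit_crystal_def string_length_orbit_e[OF i])
    show "phi (young_crystal T) i (\<psi> \<mu>) = phi ?B i \<mu>"
      using the_elem_young_class[OF Y, of "column_phi T i"] column_phi_eq[OF Ys i] column_phi_eq[OF Y i]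
        ex_addable_shift wt
      by (simp add: \<mu> \<psi>[OF Y] young_crystal_def orbit_crystal_def string_length_orbit_f[OF i])
    \<comment> \<open>The class of the result is a function of the weight, which the shift
      preserves, so \<open>the_elem\<close> is applied to a singleton.\<close>
    have "map_option (young_class T) (column_e T i (shift (n * P) Y)) =
        map_option (young_class T) (column_e T i Y)" for n
      using e[OF Ys i] e[OF Y i] column_wt_shift[OF Y] by metis
    then show "eop (young_crystal T) i (\<psi> \<mu>) = map_option \<psi> (eop ?B i \<mu>)"
      using the_elem_young_class[OF Y, of "\<lambda>Y. map_option (young_class T) (column_e T i Y)"] e[OF Y i]
      by (simp add: \<mu> \<psi>[OF Y] young_crystal_def orbit_crystal_def)
    have "map_option (young_class T) (column_f T i (shift (n * P) Y)) =
        map_option (young_class T) (column_f T i Y)" for n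
      using f[OF Ys i] f[OF Y i] column_wt_shift[OF Y] by metis
    then show "fop (young_crystal T) i (\<psi> \<mu>) = map_option \<psi> (fop ?B i \<mu>)"
      using the_elem_young_class[OF Y, of "\<lambda>Y. map_option (young_class T) (column_f T i Y)"] f[OF Y i]
      by (simp add: \<mu> \<psi>[OF Y] young_crystal_def orbit_crystal_def)
  qed
  then show ?thesis by blast
qed

text \<open>Here \<open>c i\<close> is the cube of the top \<open>i\<close>-block. By
  \<open>closed\<close> the set is an ideal. By \<open>reach\<close> and \<open>bound\<close> each
  top block is joined to \<open>(1, 0)\<close> by an ascending chain of adjacent colours, so every
  column containing \<open>(1, 0)\<close> contains all top blocks.\<close>

lemma least_columnI:
  assumes zero: "c 0 = 1"
    and occurs: "\<And>i. i \<in> index_set T \<Longrightarrow> (c i, i) \<in> H"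
    and closed: "\<And>i j k. adj T i j \<Longrightarrow> c j < k \<Longrightarrow> k < c i \<Longrightarrow> (k, j) \<notin> H"
    and reach: "\<And>i. i \<in> index_set T \<Longrightarrow> i \<noteq> 0 \<Longrightarrow> \<exists>j\<in>index_set T. adj T j i \<and> c i < c j"
    and bound: "\<And>i. i \<in> index_set T \<Longrightarrow> c i \<le> 1"
  shows "least_column {(k, i). (k, i) \<in> H \<and> k \<le> c i}" (is ?least)
    and "\<And>i. i \<in> index_set T \<Longrightarrow> column_wt T {(k, i). (k, i) \<in> H \<and> k \<le> c i} i =
      int (card {(l, j). (l, j) \<in> H \<and> adj T i j \<and> c i < l \<and> l \<le> c j}) - 1"
proof -
  let ?J = "{(k, i). (k, i) \<in> H \<and> k \<le> c i}"
  have J: "young_column T ?J"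
  proof (rule young_columnI)
    show "?J \<noteq> {}" using occurs zero_index by blast
    show "?J \<subseteq> H" by blast
    show "k \<le> 1" if "(k, i) \<in> ?J" for k i
      using that bound block_colour by fastforce
    show "(k - 1, j) \<in> ?J" if "(k, i) \<in> ?J" "(k - 1, j) \<in> H" "adj T i j" for k i j
      using that closed[of i j "k - 1"] by force
  qed
  have "(c i, i) \<in> Y" if Y: "young_column T Y" "(1, 0) \<in> Y" and "i \<in> index_set T" for Y i
    using that(3)
  proof (induction "nat (1 - c i)" arbitrary: i rule: less_induct)
    case less
    show ?case
    proof (cases "i = 0")
      case False
      then obtain j where j: "j \<in> index_set T" "adj T j i" "c i < c j" using reach less by blast
      then have "(c j, j) \<in> Y" using less.hyps[of j] bound[of j] by simp
      then show ?thesis using young_column_below[OF Y(1)] j occurs less.prems by blast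
    qed (use zero Y in simp)
  qed
  then have "(k, i) \<in> Y" if "young_column T Y" "(1, 0) \<in> Y" "(k, i) \<in> H" "k \<le> c i" for Y k i
    using young_column_below[OF that(1), of "c i" i k i] that block_colour[OF that(3)]
    by (cases "k = c i") auto
  then have "?J \<subseteq> Y" if "young_column T Y" "(1, 0) \<in> Y" for Y
    using that by blast
  then show ?least
    using J occurs[OF zero_index] zero by (auto simp: least_column_def)
  fix i assume i: "i \<in> index_set T"
  have "is_top ?J i (c i)" using occurs[OF i] by (auto simp: is_top_def)
  moreover have "{(l, j) \<in> ?J. adj T i j \<and> c i < l} =
      {(l, j). (l, j) \<in> H \<and> adj T i j \<and> c i < l \<and> l \<le> c j}" by auto
  ultimately show "column_wt T ?J i =
      int (card {(l, j). (l, j) \<in> H \<and> adj T i j \<and> c i < l \<and> l \<le> c j}) - 1"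
    using column_wt_top[OF J i] by simp
qed

end

section \<open>The patterns of types E6(1) and E7(1)\<close>

definition cell_list :: "affine_type \<Rightarrow> cell list" where
  "cell_list T = map (Pair Upper) [1..<Suc (width T)] @ map (Pair Lower) [1..<Suc (width T)]"

definition colours_at :: "affine_type \<Rightarrow> int \<Rightarrow> nat list" where
  "colours_at T k = map (colour T k) (cell_list T)"

lemma set_cell_list: "set (cell_list T) = cells T"
proof (rule set_eqI)
  fix p :: cell
  obtain r c where "p = (r, c)" by (cases p)
  then show "p \<in> set (cell_list T) \<longleftrightarrow> p \<in> cells T"
    by (cases r) (auto simp: cell_list_def cells_def simp del: upt_Suc)
qed

lemma mem_blocks_iff: "(k, i) \<in> blocks T \<longleftrightarrow> i \<in> set (colours_at T k)"
  by (auto simp: blocks_def colours_at_def set_cell_list)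

lemma rotate_cell_cells: "p \<in> cells T \<Longrightarrow> rotate_cell T p \<in> cells T \<and> rotate_cell T (rotate_cell T p) = p"
  by (cases "(T, p)" rule: rotate_cell.cases) (auto simp: cells_def)

lemma footprint_rotate:
  assumes "\<And>p. p \<in> cells T \<Longrightarrow> colour T l (rotate_cell T p) = colour T k p"
  shows "footprint T (l, i) = rotate_cell T ` footprint T (k, i)"
proof (intro equalityI subsetI)
  fix p assume "p \<in> footprint T (l, i)"
  then have "p = rotate_cell T (rotate_cell T p)" "rotate_cell T p \<in> footprint T (k, i)"
    using rotate_cell_cells[of p T] assms[of "rotate_cell T p"] by auto
  then show "p \<in> rotate_cell T ` footprint T (k, i)" by blast
qed (use rotate_cell_cells assms in auto)

lemma rotate_section_involution: "rotate_section (rotate_section s) = s"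
  by (cases s) simp

text \<open>The quotient \<open>(k - 1) div 6\<close> grows by \<open>n\<close>, and its parity
  alone decides whether a cube is rotated.\<close>

lemma cube_E6_add:
  "cube E6 (k + n * 6) = (if even n then cube E6 k else rotate_section (cube E6 k))"
proof -
  have "k + n * 6 - 1 = (k - 1) + n * 6" by simp
  then have "(k + n * 6 - 1) mod 6 = (k - 1) mod 6" "(k + n * 6 - 1) div 6 = (k - 1) div 6 + n"
    by (simp_all only: mod_mult_self1 div_mult_self1 zero_neq_numeral[symmetric] not_False_eq_True)
  then show ?thesis by (auto simp: Let_def rotate_section_involution)
qed

lemma cube_E7_add: "cube E7 (k + n * 8) = cube E7 k"
proof -
  have "k + n * 8 - 1 = (k - 1) + n * 8" by simp
  then have "(k + n * 8 - 1) mod 8 = (k - 1) mod 8" by (simp only: mod_mult_self1)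
  then show ?thesis by simp
qed

lemma length_cube_E6: "length (fst (cube E6 k)) = 2 \<and> length (snd (cube E6 k)) = 2"
proof -
  have "\<forall>s \<in> set (cube_list E6). length (fst s) = 2 \<and> length (snd s) = 2" by simp
  moreover have "cube_list E6 ! nat ((k - 1) mod 6) \<in> set (cube_list E6)"
    by (rule nth_mem) (simp add: nat_less_iff)
  ultimately have "length (fst (cube_list E6 ! nat ((k - 1) mod 6))) = 2 \<and>
      length (snd (cube_list E6 ! nat ((k - 1) mod 6))) = 2" by blast
  then show ?thesis
    by (cases "cube_list E6 ! nat ((k - 1) mod 6)") (simp add: Let_def del: cube_list.simps)
qed

lemma symmetry_E6: "\<exists>r. \<forall>k i. footprint E6 (k + n * 6, i) =
    (if r then rotate_cell E6 else id) ` footprint E6 (k, i)"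
proof (cases "even n")
  case True
  then have "colour E6 (k + n * 6) p = colour E6 k p" for k p
    using cube_E6_add[of k n] by (cases p; cases "fst p") (simp_all del: cube.simps)
  then show ?thesis by (intro exI[of _ False]) simp
next
  case False
  have "footprint E6 (k + n * 6, i) = rotate_cell E6 ` footprint E6 (k, i)" for k i
  proof (rule footprint_rotate)
    fix p assume p: "p \<in> cells E6"
    obtain u l where ul: "cube E6 k = (u, l)" by (cases "cube E6 k")
    then have len: "length u = 2" "length l = 2" using length_cube_E6[of k] by (simp_all del: cube.simps)
    have cube': "cube E6 (k + n * 6) = (rev l, rev u)" using cube_E6_add[of k n] False ul by (simp del: cube.simps)
    obtain r c where rc: "p = (r, c)" by (cases p)
    then have "c = 1 \<or> c = 2" using p by (auto simp: cells_def)
    then show "colour E6 (k + n * 6) (rotate_cell E6 p) = colour E6 k p"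
      using ul len cube' rc by (cases r) (auto simp: rev_nth simp del: cube.simps)
  qed
  then show ?thesis by (intro exI[of _ True]) (simp del: footprint.simps)
qed

lemma symmetry_E7: "\<exists>r. \<forall>k i. footprint E7 (k + n * 8, i) =
    (if r then rotate_cell E7 else id) ` footprint E7 (k, i)"
proof -
  have "colour E7 (k + n * 8) p = colour E7 k p" for k p
    using cube_E7_add[of k n] by (cases p; cases "fst p") (simp_all del: cube.simps)
  then show ?thesis by (intro exI[of _ False]) simp
qed

section \<open>Decidable checks over one period\<close>

lemma periodic_int:
  fixes P :: int
  assumes "0 < P" "\<And>k n. R (k + n * P) \<longleftrightarrow> R k" "\<forall>k \<in> set [0..P - 1]. R k"
  shows "R k"
proof -
  have "R (k mod P)" using assms(1,3) by simp
  then have "R (k mod P + (k div P) * P)" using assms(2) by blast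
  then show ?thesis by simp
qed

text \<open>An evaluable form of \<open>next_block\<close>, with \<open>d\<close> the distance to
  the next \<open>i\<close>-block. The cubes \<open>k + 1\<close> and \<open>k + (d - 1)\<close>
  coincide exactly for \<open>d = 2\<close>, so only then must the colours differ.\<close>

definition next_block_check :: "affine_type \<Rightarrow> int \<Rightarrow> nat \<Rightarrow> bool" where
  "next_block_check T k i \<longleftrightarrow> (\<exists>d \<in> {2, 4, 6, 8}. i \<in> set (colours_at T (k + d)) \<and>
    (\<forall>e \<in> set [1..d - 1]. i \<notin> set (colours_at T (k + e))) \<and>
    (\<exists>j \<in> set (colours_at T (k + 1)). \<exists>j' \<in> set (colours_at T (k + (d - 1))).
      adj T i j \<and> adj T i j' \<and> (d \<noteq> 2 \<or> j \<noteq> j') \<and> (d = 2 \<or> j = j') \<and>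
      (\<forall>e \<in> set [1..d - 1]. \<forall>m \<in> set (colours_at T (k + e)).
        adj T i m \<longrightarrow> (e, m) \<in> {(1, j), (d - 1, j')})))"

definition cube_check :: "affine_type \<Rightarrow> int \<Rightarrow> int \<Rightarrow> bool" where
  "cube_check T P k \<longleftrightarrow> (0 \<in> set (colours_at T k) \<longleftrightarrow> P dvd k - 1) \<and>
    (\<forall>i \<in> set (colours_at T k). i \<in> index_set T \<and> next_block_check T k i \<and>
      (\<forall>j \<in> set (colours_at T k). \<not> adj T i j))"

text \<open>The cells \<open>p\<close> and \<open>q\<close> stand for the blocks containing them,
  and \<open>s\<close> for a cell common to both footprints.\<close>

definition cover_check :: "affine_type \<Rightarrow> int \<Rightarrow> bool" where
  "cover_check T k \<longleftrightarrow> (\<forall>p \<in> set (cell_list T). \<forall>q \<in> set (cell_list T).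
    (\<exists>s \<in> set (cell_list T). colour T k s = colour T k p \<and> colour T (k - 1) s = colour T (k - 1) q)
    \<longleftrightarrow> adj T (colour T k p) (colour T (k - 1) q))"

lemma next_block_checkD:
  assumes "next_block_check T k i"
  shows "\<exists>u j j'. k + 1 < u \<and> (u, i) \<in> blocks T \<and>
      (\<forall>l. k < l \<longrightarrow> l < u \<longrightarrow> (l, i) \<notin> blocks T) \<and>
      (\<forall>l m. k < l \<and> l < u \<and> adj T i m \<and> (l, m) \<in> blocks T \<longleftrightarrow>
        (l, m) \<in> {(k + 1, j), (u - 1, j')}) \<and>
      (k + 1, j) \<noteq> (u - 1, j') \<and> (u = k + 2 \<or> j = j')"
proof -
  obtain d where d: "d \<in> {2, 4, 6, 8}" "(k + d, i) \<in> blocks T"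
    and none: "\<forall>e \<in> set [1..d - 1]. (k + e, i) \<notin> blocks T"
    and ex: "\<exists>j \<in> set (colours_at T (k + 1)). \<exists>j' \<in> set (colours_at T (k + (d - 1))).
      adj T i j \<and> adj T i j' \<and> (d \<noteq> 2 \<or> j \<noteq> j') \<and> (d = 2 \<or> j = j') \<and>
      (\<forall>e \<in> set [1..d - 1]. \<forall>m \<in> set (colours_at T (k + e)).
        adj T i m \<longrightarrow> (e, m) \<in> {(1, j), (d - 1, j')})"
    using assms unfolding next_block_check_def mem_blocks_iff by blast
  from ex obtain j j' where j: "(k + 1, j) \<in> blocks T" "adj T i j"
    and j': "(k + (d - 1), j') \<in> blocks T" "adj T i j'"
    and jj: "d \<noteq> 2 \<or> j \<noteq> j'" "d = 2 \<or> j = j'"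
    and only: "\<forall>e \<in> set [1..d - 1]. \<forall>m \<in> set (colours_at T (k + e)).
      adj T i m \<longrightarrow> (e, m) \<in> {(1, j), (d - 1, j')}"
    unfolding mem_blocks_iff by blast
  have d2: "2 \<le> d" using d(1) by auto
  have between: "(l, i) \<notin> blocks T" if "k < l" "l < k + d" for l
    using bspec[OF none, of "l - k"] that by simp
  have nbrs: "k < l \<and> l < k + d \<and> adj T i m \<and> (l, m) \<in> blocks T \<longleftrightarrow>
      (l, m) \<in> {(k + 1, j), (k + d - 1, j')}" for l m
  proof
    assume "k < l \<and> l < k + d \<and> adj T i m \<and> (l, m) \<in> blocks T"
    then show "(l, m) \<in> {(k + 1, j), (k + d - 1, j')}"
      using bspec[OF only, of "l - k"] by (auto simp: mem_blocks_iff)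
  next
    assume "(l, m) \<in> {(k + 1, j), (k + d - 1, j')}"
    then show "k < l \<and> l < k + d \<and> adj T i m \<and> (l, m) \<in> blocks T"
      using j j' d2 by (auto simp: add_diff_eq)
  qed
  show ?thesis
    using d2 d(2) between nbrs jj by (intro exI[of _ "k + d"] exI[of _ j] exI[of _ j']) auto
qed

text \<open>Two periods are involved. \<open>cube_check\<close> sees only the set of colours in each
  cube, which rotation preserves, so it has period \<open>P\<close>; \<open>cover_check\<close> sees
  the positions of cells and has the period \<open>Q\<close> of the colouring, which is twice
  \<open>P\<close> in type E6.\<close>

lemma full_heapI:
  assumes P: "0 < P" and Q: "0 < Q"
    and symmetry: "\<And>n. \<exists>r. \<forall>k i. footprint T (k + n * P, i) =
      (if r then rotate_cell T else id) ` footprint T (k, i)"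
    and colour_period: "\<And>k n p. colour T (k + n * Q) p = colour T k p"
    and cube_check: "\<forall>k \<in> set [0..P - 1]. cube_check T P k"
    and cover_check: "\<forall>k \<in> set [0..Q - 1]. cover_check T k"
    and occurs: "\<forall>i \<in> index_set T. \<exists>k \<in> set [0..P - 1]. i \<in> set (colours_at T k)"
    and connected: "\<And>S. S \<subseteq> index_set T \<Longrightarrow> S \<noteq> {} \<Longrightarrow>
      (\<And>i j. i \<in> S \<Longrightarrow> adj T i j \<Longrightarrow> j \<in> S) \<Longrightarrow> S = index_set T"
    and adj_index: "\<And>i j. adj T i j \<Longrightarrow> j \<in> index_set T"
    and zero_index: "0 \<in> index_set T"
  shows "full_heap T P"
proof -
  have period: "set (colours_at T (k + n * P)) = set (colours_at T k)" for k n
  proof -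
    obtain r where "\<And>i. footprint T (k + n * P, i) =
      (if r then rotate_cell T else id) ` footprint T (k, i)" using symmetry by blast
    then have "footprint T (k + n * P, i) = {} \<longleftrightarrow> footprint T (k, i) = {}" for i by simp
    then have "(k + n * P, i) \<in> blocks T \<longleftrightarrow> (k, i) \<in> blocks T" for i by (simp add: blocks_def)
    then show ?thesis by (auto simp: mem_blocks_iff)
  qed
  have period': "set (colours_at T (k + n * P + e)) = set (colours_at T (k + e))" for k n e
    using period[of "k + e" n] by (simp add: algebra_simps)
  have "P dvd k + n * P - 1 \<longleftrightarrow> P dvd k - 1" for k n
    using dvd_add_times_triv_right_iff[of P "k - 1" n] by (simp add: algebra_simps)
  then have "cube_check T P (k + n * P) \<longleftrightarrow> cube_check T P k" for k n
    by (simp add: cube_check_def next_block_check_def period period')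
  then have cube: "cube_check T P k" for k
    using periodic_int[OF P, of "cube_check T P"] cube_check by blast
  have "cover_check T (k + n * Q) \<longleftrightarrow> cover_check T k" for k n
    using colour_period[of "k - 1" n] colour_period[of k n]
    by (simp add: cover_check_def algebra_simps)
  then have cover: "cover_check T k" for k
    using periodic_int[OF Q, of "cover_check T"] cover_check by blast
  show ?thesis
  proof
    fix k i j
    assume "(k, i) \<in> blocks T" "(k - 1, j) \<in> blocks T"
    then obtain p q where "p \<in> cells T" "colour T k p = i" "q \<in> cells T" "colour T (k - 1) q = j"
      by (auto simp: blocks_def)
    then show "footprint T (k, i) \<inter> footprint T (k - 1, j) \<noteq> {} \<longleftrightarrow> adj T i j"
      using cover[of k] unfolding cover_check_def set_cell_list by auto
  qed (use P symmetry connected adj_index zero_index cube occurs next_block_checkD in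
      \<open>auto simp: mem_blocks_iff cube_check_def\<close>)
qed

text \<open>
  A function \<open>c\<close> gives the cube of the top \<open>i\<close>-block of the least column for each colour \<open>i\<close>.
\<close>

definition upper_neighbours :: "affine_type \<Rightarrow> (nat \<Rightarrow> int) \<Rightarrow> nat \<Rightarrow> block set" where
  "upper_neighbours T c i = (\<Union>j \<in> index_set T. if adj T i j
    then (\<lambda>l. (l, j)) ` Set.filter (\<lambda>l. j \<in> set (colours_at T l)) (set [c i + 1..c j]) else {})"

text \<open>The hypotheses of \<open>least_columnI\<close> at colour \<open>i\<close> in a form that
  can be evaluated, together with the weight of the least column there.\<close>

definition top_check :: "affine_type \<Rightarrow> (nat \<Rightarrow> int) \<Rightarrow> weight \<Rightarrow> nat \<Rightarrow> bool" where
  "top_check T c \<nu> i \<longleftrightarrow> i \<in> set (colours_at T (c i)) \<and> c i \<le> 1 \<and>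
    (\<forall>j \<in> index_set T. adj T i j \<longrightarrow> (\<forall>k \<in> set [c j + 1..c i - 1]. j \<notin> set (colours_at T k))) \<and>
    (i \<noteq> 0 \<longrightarrow> (\<exists>j \<in> index_set T. adj T j i \<and> c i < c j)) \<and>
    int (card (upper_neighbours T c i)) - 1 = \<nu> i"

context full_heap
begin

lemma crystal_isomorphism_check:
  assumes zero: "c 0 = 1" and check: "\<forall>i \<in> index_set T. top_check T c \<nu> i"
    and \<nu>: "\<And>i. i \<notin> index_set T \<Longrightarrow> \<nu> i = 0"
  shows "\<exists>\<psi>. crystal_isomorphism T (orbit_crystal T \<nu>) (young_crystal T) \<psi>"
proof -
  let ?J = "{(k, i). (k, i) \<in> H \<and> k \<le> c i}"
  have occurs: "(c i, i) \<in> H" if "i \<in> index_set T" for i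
    using that check by (auto simp: top_check_def mem_blocks_iff)
  have closed: "(k, j) \<notin> H" if "adj T i j" "c j < k" "k < c i" for i j k
    using that check adj_index[of i j] adj_index[of j i] adj_commute[of i j T]
    by (auto simp: top_check_def mem_blocks_iff)
  have reach: "\<exists>j \<in> index_set T. adj T j i \<and> c i < c j" if "i \<in> index_set T" "i \<noteq> 0" for i
    using that check by (auto simp: top_check_def)
  have bound: "c i \<le> 1" if "i \<in> index_set T" for i
    using that check by (auto simp: top_check_def)
  have J: "least_column ?J"
    by (rule least_columnI) (fact zero occurs closed reach bound)+
  have wt: "column_wt T ?J i =
      int (card {(l, j). (l, j) \<in> H \<and> adj T i j \<and> c i < l \<and> l \<le> c j}) - 1"
    if "i \<in> index_set T" for i
    using that by (rule least_columnI(2)[rotated -1]) (fact zero occurs closed reach bound)+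
  have "{(l, j). (l, j) \<in> H \<and> adj T i j \<and> c i < l \<and> l \<le> c j} = upper_neighbours T c i" for i
    using adj_index by (force simp: upper_neighbours_def mem_blocks_iff split: if_splits)
  then have "column_wt T ?J i = \<nu> i" if "i \<in> index_set T" for i
    using wt[OF that] check that by (simp add: top_check_def)
  moreover have "column_wt T ?J i = \<nu> i" if "i \<notin> index_set T" for i
    using \<nu>[OF that] that by (simp add: column_wt_def)
  ultimately have "column_wt T ?J = \<nu>" by blast
  then show ?thesis using crystal_isomorphism_young[OF J] by simp
qed

end

section \<open>Evaluation in the two types\<close>

lemma full_heap_E6: "full_heap E6 6"
proof (rule full_heapI[where Q = 12])
  show "\<exists>r. \<forall>k i. footprint E6 (k + n * 6, i) =
      (if r then rotate_cell E6 else id) ` footprint E6 (k, i)" for n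
    by (rule symmetry_E6)
  show "colour E6 (k + n * 12) p = colour E6 k p" for k n p
    using cube_E6_add[of k "2 * n"]
    by (cases p; cases "fst p") (simp_all add: mult.commute del: cube.simps)
  show "\<forall>k \<in> set [0..6 - 1]. cube_check E6 6 k" by code_simp
  show "\<forall>k \<in> set [0..12 - 1]. cover_check E6 k" by code_simp
  show "\<forall>i \<in> index_set E6. \<exists>k \<in> set [0..6 - 1]. i \<in> set (colours_at E6 k)" by code_simp
  show "j \<in> index_set E6" if "adj E6 i j" for i j
    using that by (auto simp: doubleton_eq_iff)
  fix S assume S: "S \<subseteq> index_set E6" "S \<noteq> {}" and cl: "\<And>i j. i \<in> S \<Longrightarrow> adj E6 i j \<Longrightarrow> j \<in> S"
  have "i \<in> S \<longleftrightarrow> j \<in> S" if "adj E6 i j" for i j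
    using cl[of i j] cl[of j i] that adj_commute by blast
  \<comment> \<open>Following the edges of the tree, membership of each node is compared with that
    of the branch node 4.\<close>
  from this[of 1 3] this[of 3 4] this[of 4 5] this[of 5 6] this[of 4 2] this[of 2 0]
  have "0 \<in> S \<longleftrightarrow> 4 \<in> S" "1 \<in> S \<longleftrightarrow> 4 \<in> S" "2 \<in> S \<longleftrightarrow> 4 \<in> S" "3 \<in> S \<longleftrightarrow> 4 \<in> S"
    "5 \<in> S \<longleftrightarrow> 4 \<in> S" "6 \<in> S \<longleftrightarrow> 4 \<in> S" by auto
  moreover have "index_set E6 = {0, 1, 2, 3, 4, 5, 6}" by code_simp
  ultimately show "S = index_set E6" using S by auto
qed simp_all

lemma full_heap_E7: "full_heap E7 8"
proof (rule full_heapI[where Q = 8])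
  show "\<exists>r. \<forall>k i. footprint E7 (k + n * 8, i) =
      (if r then rotate_cell E7 else id) ` footprint E7 (k, i)" for n
    by (rule symmetry_E7)
  show "colour E7 (k + n * 8) p = colour E7 k p" for k n p
    using cube_E7_add[of k n] by (cases p; cases "fst p") (simp_all del: cube.simps)
  show "\<forall>k \<in> set [0..8 - 1]. cube_check E7 8 k" by code_simp
  show "\<forall>k \<in> set [0..8 - 1]. cover_check E7 k" by code_simp
  show "\<forall>i \<in> index_set E7. \<exists>k \<in> set [0..8 - 1]. i \<in> set (colours_at E7 k)" by code_simp
  show "j \<in> index_set E7" if "adj E7 i j" for i j
    using that by (auto simp: doubleton_eq_iff)
  fix S assume S: "S \<subseteq> index_set E7" "S \<noteq> {}" and cl: "\<And>i j. i \<in> S \<Longrightarrow> adj E7 i j \<Longrightarrow> j \<in> S"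
  have "i \<in> S \<longleftrightarrow> j \<in> S" if "adj E7 i j" for i j
    using cl[of i j] cl[of j i] that adj_commute by blast
  from this[of 0 1] this[of 1 3] this[of 3 4] this[of 4 5] this[of 5 6] this[of 6 7] this[of 4 2]
  have "0 \<in> S \<longleftrightarrow> 4 \<in> S" "1 \<in> S \<longleftrightarrow> 4 \<in> S" "2 \<in> S \<longleftrightarrow> 4 \<in> S" "3 \<in> S \<longleftrightarrow> 4 \<in> S"
    "5 \<in> S \<longleftrightarrow> 4 \<in> S" "6 \<in> S \<longleftrightarrow> 4 \<in> S" "7 \<in> S \<longleftrightarrow> 4 \<in> S" by auto
  moreover have "index_set E7 = {0, 1, 2, 3, 4, 5, 6, 7}" by code_simp
  ultimately show "S = index_set E7" using S by auto
qed simp_all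

text \<open>Walking outwards from node 0 along the diagram, each entry is the highest cube with a
  block of that colour strictly below the entry of the preceding node. Thus colour 1 drops to cube
  -7, its block in cube -1 being above the top 3-block in cube -2.\<close>

definition top_E6 :: "nat \<Rightarrow> int" where
  "top_E6 i = [1, -7, 0, -2, -1, -2, -3] ! i"

definition top_E7 :: "nat \<Rightarrow> int" where
  "top_E7 i = [1, 0, -3, -1, -2, -3, -4, -11] ! i"

theorem proposition3p13:
  shows "(\<exists>\<psi>. crystal_isomorphism E6 B6 C6 \<psi>) \<and> (\<exists>\<psi>. crystal_isomorphism E7 B7 C7 \<psi>)"
proof
  \<comment> \<open>Two 3-blocks lie above the top 1-block of the least column, no 2-block above its
    top 0-block, and exactly one block of adjacent colour above every other top block. This is the
    generating weight of \<open>B6\<close>.\<close>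
  have "\<forall>i \<in> index_set E6. top_check E6 top_E6 (\<lambda>i. if i = 1 then 1 else if i = 0 then -1 else 0) i"
    by code_simp
  moreover have "(\<lambda>i. if i = 1 then 1 else if i = 0 then -1 else 0) = fund_weight 1 - fund_weight 0"
    by (auto simp: fund_weight_def)
  ultimately show "\<exists>\<psi>. crystal_isomorphism E6 B6 C6 \<psi>"
    unfolding B6_def C6_def
    by (intro full_heap.crystal_isomorphism_check[OF full_heap_E6, of top_E6])
      (auto simp: top_E6_def fund_weight_def)
  \<comment> \<open>Now colour 7 is the one with two upper neighbours, both of colour 6, and colour
    0 again has none.\<close>
  have "\<forall>i \<in> index_set E7. top_check E7 top_E7 (\<lambda>i. if i = 7 then 1 else if i = 0 then -1 else 0) i"
    by code_simp
  moreover have "(\<lambda>i. if i = 7 then 1 else if i = 0 then -1 else 0) = fund_weight 7 - fund_weight 0"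
    by (auto simp: fund_weight_def)
  ultimately show "\<exists>\<psi>. crystal_isomorphism E7 B7 C7 \<psi>"
    unfolding B7_def C7_def
    by (intro full_heap.crystal_isomorphism_check[OF full_heap_E7, of top_E7])
      (auto simp: top_E7_def fund_weight_def)
qed

end
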